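(* Let $0<q<1$, $r\ge 1$, $\vec n=(n_1,\dots,n_r)\in\mathbb{N}^r$ (with $0\in\mathbb N$), and $|\vec n|=n_1+\cdots+n_r$. Let $\vec a=(a_1,\dots,a_r)$ and $b,c$ be parameters with $|a_j|,|b|,|c|<1$, $b\neq 0$, $a_j=q^{\alpha_j}$ (so $a_j\ne 0$), and $\alpha_i-\alpha_j\notin\mathbb{Z}$ for $i\ne j$ (meaning that $a_i/a_j$ is not an integer power of $q$ for $i\neq j$). Then the multiple continuous dual $q$-Hahn polynomial $p_{\vec n}(x;\vec a,b,c|q)$ for the weights $w(\theta;a_1,b,c|q),\dots,w(\theta;a_r,b,c|q)$ is given by $$p_{\vec n}(x;\vec a,b,c|q)=T_{b,c}\,q_{\vec n}\left(x;\tfrac{b}{q}\vec a\,\middle|\,q\right),$$ that is, the polynomial on the right-hand side has degree $|\vec n|$ and satisfies $$\int_{-1}^1 p_{\vec n}(x;\vec a,b,c|q)\,x^\ell\, w(\theta;a_j,b,c|q)\,\frac{dx}{\sqrt{1-x^2}}=0,\qquad 0\le \ell\le n_j-1,\ 1\le j\le r,\quad x=\cos\theta .$$ Moreover, with $x=\cos\theta$ and $|\vec k|=k_1+\cdots+k_r$, it has the explicit expression $$p_{\vec n}(x;\vec a,b,c|q)=\sum_{k_1=0}^{n_1}\cdots\sum_{k_r=0}^{n_r}\ \prod_{j=1}^r\frac{(q^{-n_j};q)_{k_j}}{(q;q)_{k_j}(a_jb;q)_{k_j}}\ \prod_{j=1}^{r-1}\frac{(a_jbq^{n_j};q)_{k_{j+1}+\cdots+k_r}}{(a_jbq^{k_j};q)_{k_{j+1}+\cdots+k_r}}\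 \frac{q^{|\vec k|}}{q^{\sum_{j=1}^r n_j\sum_{i=j+1}^r k_i}}\ \frac{(be^{i\theta},be^{-i\theta};q)_{|\vec k|}}{(bc;q)_{|\vec k|}} .$$
   Context: Notation: $(z;q)_k=\prod_{j=0}^{k-1}(1-zq^j)$, $(z;q)_\infty=\prod_{j\ge0}(1-zq^j)$, $(z_1,\dots,z_m;q)_k=\prod_i (z_i;q)_k$ (also for $k=\infty$). Continuous dual $q$-Hahn weight ($x=\cos\theta$): $$w(\theta;a,b,c|q)=\frac{(e^{2i\theta},e^{-2i\theta};q)_\infty}{(ae^{i\theta},ae^{-i\theta},be^{i\theta},be^{-i\theta},ce^{i\theta},ce^{-i\theta};q)_\infty}.$$ $T_{b,c}$ is the linear map on polynomials in $x$ determined by $T_{b,c}(x^k)=\dfrac{(be^{i\theta},be^{-i\theta};q)_k}{(bc;q)_k}$, where $(be^{i\theta},be^{-i\theta};q)_k=\prod_{j=0}^{k-1}(1+b^2q^{2j}-2bq^jx)$ is a polynomial in $x=\cos\theta$. Multiple little $q$-Laguerre polynomials: for $\vec A=(A_1,\dots,A_r)$ with $0<|A_jq|<1$ and $A_i/A_j$ not an integer power of $q$ for $i\ne j$, $q_{\vec n}(x;\vec A|q)$ is the polynomial of degree $|\vec n|$, normalized by $q_{\vec n}(0;\vec A|q)=1$, which satisfies $$\sum_{k=0}^\infty q_{\vec n}(q^k;\vec A|q)\,q^{k\ell}\,\frac{(A_jq)^k}{(q;q)_k}=0,\qquad 0\le\ell\le n_j-1,\ 1\le j\le r;$$ these conditions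 determine it uniquely. Here $\frac bq\vec a=(\frac{a_1b}{q},\dots,\frac{a_rb}{q})$. The multiple (type II) continuous dual $q$-Hahn polynomial for $\vec n$ is the polynomial of degree $|\vec n|$ satisfying the displayed integral orthogonality conditions; under the stated assumptions these determine it uniquely up to a multiplicative constant. *)

theory Defs
  imports "HOL-Analysis.Analysis" "HOL-Computational_Algebra.Polynomial"
begin

definition qpoch :: "complex \<Rightarrow> real \<Rightarrow> nat \<Rightarrow> complex" where
  "qpoch z q k = (\<Prod>j<k. 1 - z * of_real q ^ j)"

definition qpoch_inf :: "complex \<Rightarrow> real \<Rightarrow> complex" where
  "qpoch_inf z q = (\<Prod>j. 1 - z * of_real q ^ j)"

text \<open>Continuous dual q-Hahn weight, as a function of \<open>\<theta>\<close>.  The parameters may be complex;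
  no complex conjugation enters.\<close>

definition cdqH_weight :: "real \<Rightarrow> complex \<Rightarrow> complex \<Rightarrow> complex \<Rightarrow> real \<Rightarrow> complex" where
  "cdqH_weight q a b c \<theta> =
     (qpoch_inf (exp (2 * \<i> * of_real \<theta>)) q * qpoch_inf (exp (- 2 * \<i> * of_real \<theta>)) q) /
     (qpoch_inf (a * exp (\<i> * of_real \<theta>)) q * qpoch_inf (a * exp (- \<i> * of_real \<theta>)) q *
      qpoch_inf (b * exp (\<i> * of_real \<theta>)) q * qpoch_inf (b * exp (- \<i> * of_real \<theta>)) q *
      qpoch_inf (c * exp (\<i> * of_real \<theta>)) q * qpoch_inf (c * exp (- \<i> * of_real \<theta>)) q)"

text \<open>The polynomial \<open>(b e\<^sup>i\<^sup>\<theta>, b e\<^sup>-\<^sup>i\<^sup>\<theta>; q)\<^sub>k\<close> in \<open>x = cos \<theta>\<close>; see \<open>poly_qbasis\<close>.\<close>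

definition qbasis :: "real \<Rightarrow> complex \<Rightarrow> nat \<Rightarrow> complex poly" where
  "qbasis q b k = (\<Prod>j<k. [: 1 + b\<^sup>2 * of_real q ^ (2 * j), - 2 * b * of_real q ^ j :])"

lemma poly_qbasis:
  "poly (qbasis q b k) (of_real (cos \<theta>)) =
     qpoch (b * exp (\<i> * of_real \<theta>)) q k * qpoch (b * exp (- \<i> * of_real \<theta>)) q k"
proof -
  have c: "2 * of_real (cos \<theta>) = exp (\<i> * of_real \<theta>) + exp (- \<i> * complex_of_real \<theta>)"
    by (simp add: cos_of_real [symmetric] cos_exp_eq)
  have e: "exp (\<i> * of_real \<theta>) * exp (- \<i> * complex_of_real \<theta>) = 1"
    by (simp add: exp_add [symmetric])
  have "1 + b\<^sup>2 * of_real q ^ (2 * j) + of_real (cos \<theta>) * (- 2 * b * of_real q ^ j) =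
      (1 - b * exp (\<i> * of_real \<theta>) * of_real q ^ j) *
      (1 - b * exp (- \<i> * of_real \<theta>) * of_real q ^ j)" for j
  proof -
    have "of_real (cos \<theta>) * (- 2 * b * of_real q ^ j) =
        - b * of_real q ^ j * (exp (\<i> * of_real \<theta>) + exp (- \<i> * complex_of_real \<theta>))"
      by (subst c [symmetric]) (simp add: algebra_simps)
    moreover have "b\<^sup>2 * of_real q ^ (2 * j) =
        (b * of_real q ^ j)\<^sup>2 * (exp (\<i> * of_real \<theta>) * exp (- \<i> * complex_of_real \<theta>))"
      by (subst e) (simp add: power_mult_distrib power_mult power2_eq_square power_mult [symmetric] mult.commute)
    ultimately show ?thesis
      by (simp only:) (simp add: algebra_simps power2_eq_square)
  qed
  then show ?thesis
    by (simp add: qbasis_def qpoch_def poly_prod prod.distrib [symmetric])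
qed

definition T_op :: "real \<Rightarrow> complex \<Rightarrow> complex \<Rightarrow> complex poly \<Rightarrow> complex poly" where
  "T_op q b c p = (\<Sum>k\<le>degree p. smult (coeff p k / qpoch (b * c) q k) (qbasis q b k))"

lemma T_op_bound:
  assumes "degree p \<le> N"
  shows "T_op q b c p = (\<Sum>k\<le>N. smult (coeff p k / qpoch (b * c) q k) (qbasis q b k))"
  unfolding T_op_def using assms
  by (intro sum.mono_neutral_left) (auto simp: coeff_eq_0)

lemma T_op_monom:
  "T_op q b c (monom 1 k) = smult (1 / qpoch (b * c) q k) (qbasis q b k)"
proof -
  have "T_op q b c (monom 1 k) =
      (\<Sum>i\<le>k. if i = k then smult (1 / qpoch (b * c) q k) (qbasis q b k) else 0)"
    unfolding T_op_def by (rule sum.cong) (auto simp: degree_monom_eq)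
  then show ?thesis by simp
qed

lemma T_op_add: "T_op q b c (p + p') = T_op q b c p + T_op q b c p'"
proof -
  let ?N = "max (degree p) (degree p')"
  have "degree (p + p') \<le> ?N" by (rule degree_add_le) auto
  then show ?thesis
    by (simp add: T_op_bound [of _ ?N] add_divide_distrib smult_add_left sum.distrib)
qed

lemma T_op_smult: "T_op q b c (smult s p) = smult s (T_op q b c p)"
proof -
  have "smult s (\<Sum>k\<in>A. f k) = (\<Sum>k\<in>A. smult s (f k))" for A and f :: "nat \<Rightarrow> complex poly"
    by (induction A rule: infinite_finite_induct) (auto simp: smult_add_right)
  then show ?thesis
    by (simp add: T_op_bound [of "smult s p" "degree p"] T_op_bound [of p "degree p"])
qed

text \<open>Multi-indices \<open>n\<close> and parameter vectors are functions on \<open>nat\<close> of which only the values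
  on \<open>{1..r}\<close> matter.\<close>

definition is_multiple_little_qLaguerre ::
  "real \<Rightarrow> nat \<Rightarrow> (nat \<Rightarrow> nat) \<Rightarrow> (nat \<Rightarrow> complex) \<Rightarrow> complex poly \<Rightarrow> bool" where
  "is_multiple_little_qLaguerre q r n A p \<longleftrightarrow>
     degree p = (\<Sum>j=1..r. n j) \<and> poly p 0 = 1 \<and>
     (\<forall>j\<in>{1..r}. \<forall>l<n j.
        (\<lambda>k. poly p (of_real q ^ k) * of_real q ^ (k * l) *
             ((A j * of_real q) ^ k / qpoch (of_real q) q k)) sums 0)"

definition multiple_little_qLaguerre ::
  "real \<Rightarrow> nat \<Rightarrow> (nat \<Rightarrow> nat) \<Rightarrow> (nat \<Rightarrow> complex) \<Rightarrow> complex poly" where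
  "multiple_little_qLaguerre q r n A = (THE p. is_multiple_little_qLaguerre q r n A p)"

text \<open>The defining conditions of a (type II) multiple continuous dual q-Hahn polynomial, which fix
  it only up to a nonzero constant factor.  \<open>has_integral\<close> includes the existence of the integral.\<close>

definition is_multiple_cdqH ::
  "real \<Rightarrow> nat \<Rightarrow> (nat \<Rightarrow> nat) \<Rightarrow> (nat \<Rightarrow> complex) \<Rightarrow> complex \<Rightarrow> complex \<Rightarrow> complex poly \<Rightarrow> bool"
  where
  "is_multiple_cdqH q r n a b c p \<longleftrightarrow>
     degree p = (\<Sum>j=1..r. n j) \<and>
     (\<forall>j\<in>{1..r}. \<forall>l<n j.
        ((\<lambda>x::real. poly p (of_real x) * of_real x ^ l * cdqH_weight q (a j) b c (arccos x)
                     / of_real (sqrt (1 - x\<^sup>2))) has_integral 0) {-1..1})"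

end

theory Submission
  imports Defs "HOL-Complex_Analysis.Complex_Analysis"
begin

text \<open>
  Two linear maps on polynomials reduce the theorem to counting zeros. Write \<open>B\<^sub>j = a\<^sub>j b\<close>, and let
  \<open>S\<close> be the map with \<open>S(x\<^sup>k) = (y;q)\<^sub>k\<close>, a polynomial of degree \<open>k\<close> in \<open>y\<close>
  (\<open>qpoch_transform\<close>).

  By the q-exponential series \<open>\<Sum>\<^sub>m z\<^sup>m/(q;q)\<^sub>m = 1/(z;q)\<^sub>\<infinity>\<close>, the moment of \<open>f\<close> against the
  \<open>l\<close>-th test function of the \<open>j\<close>-th little q-Laguerre weight is a nonzero multiple of the value of
  \<open>S f\<close> at \<open>y = B\<^sub>j q\<^sup>l\<close>. On the other side, the parameters of the continuous dual q-Hahn weight shift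
  when it is multiplied by \<open>(be\<^sup>i\<^sup>\<theta>,be\<^sup>-\<^sup>i\<^sup>\<theta>;q)\<^sub>k (ae\<^sup>i\<^sup>\<theta>,ae\<^sup>-\<^sup>i\<^sup>\<theta>;q)\<^sub>l\<close>, and the dependence of its total
  mass on the parameters shows that the integral of \<open>T(f)\<close> times \<open>(a\<^sub>je\<^sup>i\<^sup>\<theta>,a\<^sub>je\<^sup>-\<^sup>i\<^sup>\<theta>;q)\<^sub>l\<close> is again a
  nonzero multiple of \<open>S f (B\<^sub>j q\<^sup>l)\<close> (\<open>cdqH_functional_T_op\<close>). So \<open>T\<close> carries little q-Laguerre
  orthogonality to continuous dual q-Hahn orthogonality, and both mean that \<open>S f\<close> vanishes at the
  points \<open>B\<^sub>j q\<^sup>l\<close> with \<open>l < n\<^sub>j\<close>. The condition on the ratios makes these \<open>|n|\<close> points distinct, so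
  \<open>S f\<close> is known up to a constant; as \<open>S\<close> and \<open>T\<close> are bijective and preserve degrees, existence,
  uniqueness and the degree of both families follow. The normalization \<open>f(0) = 1\<close> means
  \<open>S f (1) = 1\<close>.

  The mass \<open>J(a,b,c)\<close> of the weight satisfies the functional equation
  \<open>J(aq,b,c) = (1-ab)(1-ac) J(a,b,c)\<close>, and \<open>J \<noteq> 0\<close>. The first fact comes from the first moment of the
  weight, found by moving a contour from \<open>|z| = 1\<close> to \<open>|z| = q\<close>; the second follows by
  letting all the parameters tend to \<open>0\<close> along powers of \<open>q\<close>, where the weight becomes nonnegative.

  For the explicit formula, the candidate \<open>f\<close> is read off from the multiple sum, and \<open>S f\<close> is
  evaluated by summing over \<open>k\<^sub>1\<close>, then \<open>k\<^sub>2\<close>, and so on. Each step is a q-Chu-Vandermonde sum,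
  which splits off the factor with zeros \<open>B\<^sub>j q\<^sup>l\<close> (\<open>sum_multi_index\<close>).
\<close>

section \<open>q-shifted factorials\<close>

lemma qpoch_0 [simp]: "qpoch z q 0 = 1"
  by (simp add: qpoch_def)

lemma qpoch_Suc: "qpoch z q (Suc k) = qpoch z q k * (1 - z * of_real q ^ k)"
  by (simp add: qpoch_def)

lemma qpoch_add: "qpoch z q (m + n) = qpoch z q m * qpoch (z * of_real q ^ m) q n"
  by (induction n) (simp_all add: qpoch_Suc power_add mult.assoc)

lemma qpoch_Suc_left: "qpoch z q (Suc k) = (1 - z) * qpoch (z * of_real q) q k"
  using qpoch_add[of z q 1 k] by (simp add: qpoch_def)

lemma one_minus_nonzero: "norm z < 1 \<Longrightarrow> 1 - z \<noteq> 0" for z :: complex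
  by auto

lemma norm_prod_less_1: "norm a < 1 \<Longrightarrow> norm b < 1 \<Longrightarrow> norm (a * b) < 1" for a b :: complex
  by (metis norm_mult mult_strict_mono' norm_ge_zero mult_1)

locale q_base =
  fixes q :: real
  assumes q_pos: "0 < q" and q_less_1: "q < 1"
begin

lemma norm_mult_q_power_less_1: "norm z < 1 \<Longrightarrow> norm (z * of_real q ^ k) < 1" for z :: complex
  using mult_left_le_one_le[of "norm z" "q ^ k"] q_pos q_less_1
  by (simp add: norm_mult norm_power power_le_one mult.commute)

lemma one_minus_q_power_nonzero: "norm z < 1 \<Longrightarrow> 1 - z * of_real q ^ k \<noteq> 0" for z :: complex
  by (intro one_minus_nonzero norm_mult_q_power_less_1)

lemma qpoch_nonzero: "norm z < 1 \<Longrightarrow> qpoch z q k \<noteq> 0"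
  by (induction k) (use one_minus_q_power_nonzero in \<open>auto simp: qpoch_Suc\<close>)

lemma qpoch_q_nonzero: "qpoch (of_real q) q k \<noteq> 0"
  by (rule qpoch_nonzero) (use q_pos q_less_1 in auto)

lemma convergent_prod_qpoch: "convergent_prod (\<lambda>j. 1 - z * of_real q ^ j :: complex)"
proof (rule abs_convergent_prod_imp_convergent_prod, rule summable_imp_abs_convergent_prod)
  show "summable (\<lambda>j. norm (1 - z * of_real q ^ j - 1))"
    using q_pos q_less_1 by (simp add: norm_mult norm_power summable_mult)
qed

lemma qpoch_tendsto_inf: "(\<lambda>k. qpoch z q k) \<longlonglongrightarrow> qpoch_inf z q"
  using convergent_prod_LIMSEQ[OF convergent_prod_qpoch[of z]]
  unfolding qpoch_def qpoch_inf_def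
  by (subst filterlim_sequentially_Suc[symmetric]) (simp add: lessThan_Suc_atMost)

lemma qpoch_inf_nonzero: "norm z < 1 \<Longrightarrow> qpoch_inf z q \<noteq> 0"
  unfolding qpoch_inf_def
  by (rule prodinf_nonzero[OF convergent_prod_qpoch one_minus_q_power_nonzero])

lemma qpoch_inf_split: "qpoch_inf z q = qpoch z q k * qpoch_inf (z * of_real q ^ k) q"
proof (rule LIMSEQ_unique)
  show "(\<lambda>n. qpoch z q (n + k)) \<longlonglongrightarrow> qpoch_inf z q"
    by (rule LIMSEQ_ignore_initial_segment[OF qpoch_tendsto_inf])
  show "(\<lambda>n. qpoch z q (n + k)) \<longlonglongrightarrow> qpoch z q k * qpoch_inf (z * of_real q ^ k) q"
    by (subst add.commute, subst qpoch_add) (intro tendsto_intros qpoch_tendsto_inf)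
qed

lemma qpoch_inf_rec: "qpoch_inf z q = (1 - z) * qpoch_inf (z * of_real q) q"
  using qpoch_inf_split[of z 1] by (simp add: qpoch_def)

lemma qpoch_inf_0 [simp]: "qpoch_inf 0 q = 1"
  by (simp add: qpoch_inf_def)

text \<open>The partial products converge uniformly on every disc of radius \<open>1\<close> because
\<open>\<Sum> |z| q\<^sup>n\<close> does.\<close>

lemma holomorphic_qpoch_inf_UNIV: "(\<lambda>z. qpoch_inf z q) holomorphic_on UNIV"
proof (rule holomorphic_uniform_sequence)
  show "(\<lambda>z. qpoch z q n) holomorphic_on UNIV" for n
    unfolding qpoch_def by (intro holomorphic_intros)
next
  fix z0 :: complex
  have "uniformly_convergent_on (cball z0 1) (\<lambda>N z. \<Prod>n<N. 1 - z * of_real q ^ n)"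
  proof (rule uniformly_convergent_on_prod')
    show "uniformly_convergent_on (cball z0 1)
            (\<lambda>N z. \<Sum>n<N. norm (1 - z * of_real q ^ n - 1 :: complex))"
    proof (rule Weierstrass_m_test'_ev)
      show "\<forall>\<^sub>F n in sequentially. \<forall>z\<in>cball z0 1.
              norm (norm (1 - z * of_real q ^ n - 1)) \<le> (norm z0 + 1) * q ^ n"
      proof (intro always_eventually allI ballI)
        fix n z assume "z \<in> cball z0 1"
        then have "norm z \<le> norm z0 + 1"
          using norm_triangle_ineq2[of z z0] by (simp add: dist_norm norm_minus_commute)
        then show "norm (norm (1 - z * of_real q ^ n - 1)) \<le> (norm z0 + 1) * q ^ n"
          using q_pos by (simp add: norm_mult norm_power mult_right_mono)
      qed
      show "summable (\<lambda>n. (norm z0 + 1) * q ^ n)"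
        using q_pos q_less_1 by (intro summable_mult summable_geometric) auto
    qed
  qed (intro continuous_intros, simp)
  then have "uniform_limit (cball z0 1) (\<lambda>n z. qpoch z q n)
               (\<lambda>z. lim (\<lambda>n. qpoch z q n)) sequentially"
    unfolding qpoch_def uniformly_convergent_uniform_limit_iff .
  also have "(\<lambda>z. lim (\<lambda>n. qpoch z q n)) = (\<lambda>z. qpoch_inf z q)"
    using qpoch_tendsto_inf by (auto intro!: limI)
  finally show "\<exists>d>0. cball z0 d \<subseteq> UNIV \<and>
      uniform_limit (cball z0 d) (\<lambda>n z. qpoch z q n) (\<lambda>z. qpoch_inf z q) sequentially"
    by (intro exI[of _ 1]) auto
qed auto

lemma holomorphic_on_qpoch_inf [holomorphic_intros]:
  "f holomorphic_on S \<Longrightarrow> (\<lambda>z. qpoch_inf (f z) q) holomorphic_on S"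
  using holomorphic_on_compose_gen[OF _ holomorphic_qpoch_inf_UNIV, of f S]
  by (simp add: o_def)

lemma continuous_on_qpoch_inf [continuous_intros]:
  "continuous_on S f \<Longrightarrow> continuous_on S (\<lambda>z. qpoch_inf (f z) q)"
  using continuous_on_compose2[OF holomorphic_on_imp_continuous_on[OF holomorphic_qpoch_inf_UNIV]]
  by blast

text \<open>Both sides satisfy \<open>F(zq) = (1 - z) F(z)\<close>: for the series this is a comparison of coefficients.
Iterating carries \<open>z\<close> to \<open>0\<close>, where \<open>F\<close> is continuous with value \<open>1\<close>.\<close>

lemma q_exponential_sums:
  assumes z: "norm z < 1"
  shows "(\<lambda>m. z ^ m / qpoch (of_real q) q m) sums (1 / qpoch_inf z q)"
proof -
  define c where "c m = 1 / qpoch (of_real q) q m" for m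
  have c_Suc: "c (Suc m) * (1 - of_real q ^ Suc m) = c m" for m
    using one_minus_q_power_nonzero[of "of_real q" m] q_pos q_less_1 by (simp add: c_def qpoch_Suc)
  have bounded: "Bseq c"
  proof (rule convergent_imp_Bseq, rule convergentI)
    show "c \<longlonglongrightarrow> 1 / qpoch_inf (of_real q) q"
      unfolding c_def
      by (rule tendsto_divide[OF tendsto_const qpoch_tendsto_inf qpoch_inf_nonzero])
        (use q_pos q_less_1 in auto)
  qed
  then obtain K where K: "\<And>m. norm (c m) \<le> K" by (auto simp: Bseq_def)
  have summable: "summable (\<lambda>m. c m * w ^ m)" if "norm w < 1" for w
  proof (rule summable_comparison_test')
    show "summable (\<lambda>m. K * norm w ^ m)"
      using that by (intro summable_mult summable_geometric) auto
    show "norm (c m * w ^ m) \<le> K * norm w ^ m" if "m \<ge> 0" for m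
      using K[of m] by (simp add: norm_mult norm_power mult_right_mono)
  qed
  define F where "F w = (\<Sum>m. c m * w ^ m)" for w
  have F_rec: "F (w * of_real q) = (1 - w) * F w" if w: "norm w < 1" for w
  proof -
    have wq: "norm (w * of_real q) < 1" using norm_mult_q_power_less_1[OF w, of 1] by simp
    have "F w - F (w * of_real q) = (\<Sum>m. c m * w ^ m - c m * (w * of_real q) ^ m)"
      unfolding F_def by (rule suminf_diff[OF summable[OF w] summable[OF wq]])
    also have "\<dots> = (\<Sum>m. c (Suc m) * w ^ Suc m - c (Suc m) * (w * of_real q) ^ Suc m)"
      using suminf_split_head[OF summable_diff[OF summable[OF w] summable[OF wq]]] by simp
    also have "\<dots> = (\<Sum>m. w * (c m * w ^ m))"
    proof (rule suminf_cong)
      fix m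
      have "c (Suc m) * w ^ Suc m - c (Suc m) * (w * of_real q) ^ Suc m
          = (c (Suc m) * (1 - of_real q ^ Suc m)) * w ^ Suc m"
        by (simp add: algebra_simps power_mult_distrib)
      then show "c (Suc m) * w ^ Suc m - c (Suc m) * (w * of_real q) ^ Suc m = w * (c m * w ^ m)"
        unfolding c_Suc by simp
    qed
    also have "\<dots> = w * F w" unfolding F_def by (rule suminf_mult[OF summable[OF w]])
    finally show ?thesis by (simp add: algebra_simps)
  qed
  have F_iter: "F (z * of_real q ^ N) = qpoch z q N * F z" for N
  proof (induction N)
    case (Suc N)
    then show ?case
      using F_rec[OF norm_mult_q_power_less_1[OF z], of N] by (simp add: qpoch_Suc mult_ac)
  qed simp
  have "continuous (at 0) F"
    unfolding F_def by (rule isCont_powser[of _ "1/2"]) (auto intro: summable)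
  moreover have "(\<lambda>N. z * of_real q ^ N) \<longlonglongrightarrow> 0"
    by (rule tendsto_mult_right_zero, rule LIMSEQ_power_zero) (use q_pos q_less_1 in auto)
  ultimately have "(\<lambda>N. F (z * of_real q ^ N)) \<longlonglongrightarrow> F 0"
    by (rule isCont_tendsto_compose)
  moreover have "(\<lambda>N. F (z * of_real q ^ N)) \<longlonglongrightarrow> qpoch_inf z q * F z"
    unfolding F_iter by (intro tendsto_intros qpoch_tendsto_inf)
  moreover have "F 0 = 1" unfolding F_def powser_zero by (simp add: c_def)
  ultimately have "F z = 1 / qpoch_inf z q"
    using LIMSEQ_unique qpoch_inf_nonzero[OF z] by (fastforce simp: field_simps)
  then show ?thesis
    using summable_sums[OF summable[OF z]] by (simp add: F_def c_def)
qed

section \<open>The continuous dual q-Hahn weight and its first moment\<close>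

text \<open>In terms of \<open>z = e\<^sup>i\<^sup>\<theta>\<close> the weight is a meromorphic function on the punctured plane, which is what
the change of contour below needs.\<close>

lemma cdqH_weight_cis:
  "cdqH_weight q a b c \<theta> =
    (qpoch_inf ((cis \<theta>)\<^sup>2) q * qpoch_inf (1 / (cis \<theta>)\<^sup>2) q) /
    (qpoch_inf (a * cis \<theta>) q * qpoch_inf (a / cis \<theta>) q *
     qpoch_inf (b * cis \<theta>) q * qpoch_inf (b / cis \<theta>) q *
     qpoch_inf (c * cis \<theta>) q * qpoch_inf (c / cis \<theta>) q)"
proof -
  have "exp (2 * \<i> * of_real \<theta>) = (cis \<theta>)\<^sup>2"
    by (simp add: cis_conv_exp exp_double[symmetric] mult_ac)
  moreover have "exp (- 2 * \<i> * of_real \<theta>) = 1 / (cis \<theta>)\<^sup>2"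
    by (simp add: cis_conv_exp exp_double[symmetric] mult_ac exp_minus inverse_eq_divide)
  moreover have "exp (- \<i> * of_real \<theta>) = 1 / cis \<theta>"
    by (simp add: cis_conv_exp exp_minus inverse_eq_divide)
  ultimately show ?thesis
    unfolding cdqH_weight_def by (simp add: cis_conv_exp)
qed

lemma continuous_on_cdqH_weight [continuous_intros]:
  assumes "continuous_on X f" "continuous_on X g" "continuous_on X h" "continuous_on X \<theta>"
    and "\<And>x. x \<in> X \<Longrightarrow> norm (f x) < 1" "\<And>x. x \<in> X \<Longrightarrow> norm (g x) < 1"
      "\<And>x. x \<in> X \<Longrightarrow> norm (h x) < 1"
  shows "continuous_on X (\<lambda>x. cdqH_weight q (f x) (g x) (h x) (\<theta> x))"
  unfolding cdqH_weight_def
  by (intro continuous_intros assms) (simp_all add: assms qpoch_inf_nonzero norm_mult)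

lemma cdqH_weight_even: "cdqH_weight q a b c (- \<theta>) = cdqH_weight q a b c \<theta>"
  by (simp add: cdqH_weight_def mult_ac)

lemma cdqH_weight_swap12: "cdqH_weight q a b c \<theta> = cdqH_weight q b a c \<theta>"
  by (simp add: cdqH_weight_def mult_ac)

lemma cdqH_weight_swap13: "cdqH_weight q a b c \<theta> = cdqH_weight q c b a \<theta>"
  by (simp add: cdqH_weight_def mult_ac)

lemma cdqH_weight_shift:
  assumes "norm a < 1"
  shows "cdqH_weight q (a * of_real q) b c \<theta> =
    (1 + a\<^sup>2 - 2 * a * of_real (cos \<theta>)) * cdqH_weight q a b c \<theta>"
proof -
  have factors: "(1 - a * cis \<theta>) * (1 - a / cis \<theta>) = 1 + a\<^sup>2 - 2 * a * of_real (cos \<theta>)"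
  proof -
    have "cis \<theta> + 1 / cis \<theta> = 2 * of_real (cos \<theta>)"
      by (simp add: complex_eq_iff flip: cis_inverse inverse_eq_divide)
    moreover have "(1 - a * cis \<theta>) * (1 - a / cis \<theta>) = 1 + a\<^sup>2 - a * (cis \<theta> + 1 / cis \<theta>)"
      by (simp add: field_simps power2_eq_square)
    ultimately show ?thesis by simp
  qed
  have nz: "1 - a * cis \<theta> \<noteq> 0" "1 - a / cis \<theta> \<noteq> 0"
    using assms by (auto intro!: one_minus_nonzero simp: norm_mult norm_divide simp del: right_minus_eq)
  have "qpoch_inf (a * cis \<theta>) q = (1 - a * cis \<theta>) * qpoch_inf (a * of_real q * cis \<theta>) q"
    using qpoch_inf_rec[of "a * cis \<theta>"] by (simp add: mult_ac)
  moreover have "qpoch_inf (a / cis \<theta>) q = (1 - a / cis \<theta>) * qpoch_inf (a * of_real q / cis \<theta>) q"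
    using qpoch_inf_rec[of "a / cis \<theta>"] by (simp add: mult_ac)
  ultimately show ?thesis
    unfolding factors[symmetric] cdqH_weight_cis using nz by (simp add: mult_ac)
qed

text \<open>The weight with \<open>z\<close> for \<open>e\<^sup>i\<^sup>\<theta>\<close>, multiplied by \<open>(1-a/z)(1-b/z)(1-c/z) z/(1-z\<^sup>-\<^sup>2)\<close>. This factor
is chosen for two reasons. It removes the poles \<open>a, b, c\<close> of the weight inside the unit circle, so
that the kernel is holomorphic near the closed annulus \<open>q \<le> |z| \<le> 1\<close>. And it makes the kernel at
\<open>qz\<close> the negative of the kernel at \<open>1/z\<close> when \<open>|z| = 1\<close>, so that the difference of its values at \<open>z\<close> and
\<open>qz\<close> is symmetric in \<open>z\<close> and \<open>1/z\<close>; it is the weight times a polynomial in \<open>cos \<theta>\<close>.\<close>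

definition shift_kernel :: "complex \<Rightarrow> complex \<Rightarrow> complex \<Rightarrow> complex \<Rightarrow> complex" where
  "shift_kernel a b c z =
    qpoch_inf (z\<^sup>2) q * qpoch_inf (of_real q / z\<^sup>2) q * z /
    ((qpoch_inf (a * z) q * qpoch_inf (a * of_real q / z) q) *
     (qpoch_inf (b * z) q * qpoch_inf (b * of_real q / z) q) *
     (qpoch_inf (c * z) q * qpoch_inf (c * of_real q / z) q))"

text \<open>Everything is expressed through the infinite products with argument \<open>qz\<^sup>2\<close>, \<open>q/z\<^sup>2\<close>, \<open>uqz\<close> and
\<open>uq/z\<close> for the parameters \<open>u\<close>, which are common to the weight and to both values of the kernel.
What remains is a polynomial identity in \<open>z\<close> and \<open>w = 1/z\<close>.\<close>

lemma shift_kernel_diff: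
  assumes abc: "norm a < 1" "norm b < 1" "norm c < 1"
  shows "shift_kernel a b c (cis \<theta>) - shift_kernel a b c (of_real q * cis \<theta>) =
    (2 * of_real (cos \<theta>) - (a + b + c) + a * b * c) * cdqH_weight q a b c \<theta>"
proof -
  define z w where "z = cis \<theta>" and "w = 1 / cis \<theta>"
  have z: "norm z = 1" and w: "norm w = 1" and zw: "z * w = 1" and z0: "z \<noteq> 0"
    by (auto simp: z_def w_def norm_divide)
  define Q where "Q = complex_of_real q"
  have Q: "norm Q < 1" "Q \<noteq> 0" using q_pos q_less_1 by (auto simp: Q_def)
  define M N where "M = qpoch_inf (Q * z\<^sup>2) q" and "N = qpoch_inf (Q * w\<^sup>2) q"
  define U V where "U u = qpoch_inf (u * Q * z) q" and "V u = qpoch_inf (u * Q * w) q" for u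
  have UV_nz: "U u \<noteq> 0" "V u \<noteq> 0" and uz_nz: "1 - u * z \<noteq> 0" "1 - u * w \<noteq> 0"
    if "norm u < 1" for u
  proof -
    have "norm u * norm Q < 1"
      using that Q by (metis mult_strict_mono' norm_ge_zero mult_1)
    then show "U u \<noteq> 0" "V u \<noteq> 0"
      by (auto simp: U_def V_def norm_mult z w intro!: qpoch_inf_nonzero)
    show "1 - u * z \<noteq> 0" "1 - u * w \<noteq> 0"
      using that z w by (auto intro!: one_minus_nonzero simp: norm_mult simp del: right_minus_eq)
  qed
  have over_z: "x / z = x * w" "x / z\<^sup>2 = x * w\<^sup>2" for x
    by (simp_all add: w_def z_def power2_eq_square)
  have z_sq: "qpoch_inf (z\<^sup>2) q = (1 - z\<^sup>2) * M"
    using qpoch_inf_rec[of "z\<^sup>2"] by (simp add: M_def Q_def mult_ac)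
  have w_sq: "qpoch_inf (w\<^sup>2) q = (1 - w\<^sup>2) * N"
    using qpoch_inf_rec[of "w\<^sup>2"] by (simp add: N_def Q_def mult_ac)
  have uz: "qpoch_inf (u * z) q = (1 - u * z) * U u" for u
    using qpoch_inf_rec[of "u * z"] by (simp add: U_def Q_def mult_ac)
  have uw: "qpoch_inf (u * w) q = (1 - u * w) * V u" for u
    using qpoch_inf_rec[of "u * w"] by (simp add: V_def Q_def mult_ac)
  \<comment> \<open>The next three steps evaluate the numerator of the kernel at \<open>qz\<close>, where one product loses the factor
  \<open>1 - qz\<^sup>2\<close> and the other gains the factors \<open>1 - w\<^sup>2/q\<close> and \<open>1 - w\<^sup>2\<close>.\<close>
  have M_rec: "M = (1 - Q * z\<^sup>2) * qpoch_inf ((Q * z)\<^sup>2) q"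
    using qpoch_inf_rec[of "Q * z\<^sup>2"] by (simp add: M_def Q_def power2_eq_square mult_ac)
  have w_over_Q: "qpoch_inf (w\<^sup>2 / Q) q = (1 - w\<^sup>2 / Q) * ((1 - w\<^sup>2) * N)"
    using qpoch_inf_rec[of "w\<^sup>2 / Q"] Q by (simp add: w_sq flip: Q_def)
  have shifted_num: "qpoch_inf ((Q * z)\<^sup>2) q * qpoch_inf (w\<^sup>2 / Q) q * (Q * z) =
      - w * (1 - w\<^sup>2) * (M * N)"
  proof -
    have factor: "(1 - w\<^sup>2 / Q) * (Q * z) = - w * (1 - Q * z\<^sup>2)"
    proof -
      have "(1 - w\<^sup>2 / Q) * (Q * z) = Q * z - w * (z * w)"
        using Q by (simp add: field_simps power2_eq_square)
      also have "\<dots> = - w * (1 - Q * z\<^sup>2)" using zw by algebra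
      finally show ?thesis .
    qed
    have "qpoch_inf ((Q * z)\<^sup>2) q * ((1 - w\<^sup>2 / Q) * ((1 - w\<^sup>2) * N)) * (Q * z) =
        qpoch_inf ((Q * z)\<^sup>2) q * ((1 - w\<^sup>2) * N) * ((1 - w\<^sup>2 / Q) * (Q * z))"
      by (simp only: mult_ac)
    also have "\<dots> = qpoch_inf ((Q * z)\<^sup>2) q * ((1 - w\<^sup>2) * N) * (- w * (1 - Q * z\<^sup>2))"
      by (simp only: factor)
    also have "\<dots> = - w * (1 - w\<^sup>2) * (M * N)"
      unfolding M_rec by (simp only: mult_ac)
    finally show ?thesis unfolding w_over_Q .
  qed
  have at_z: "shift_kernel a b c z = z * (1 - z\<^sup>2) * (M * N) /
      (((1 - a * z) * U a * V a) * ((1 - b * z) * U b * V b) * ((1 - c * z) * U c * V c))"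
    unfolding shift_kernel_def over_z Q_def[symmetric] uz z_sq V_def[symmetric] N_def[symmetric]
    by (simp add: mult_ac)
  have at_Qz: "shift_kernel a b c (Q * z) = - w * (1 - w\<^sup>2) * (M * N) /
      (((1 - a * w) * U a * V a) * ((1 - b * w) * U b * V b) * ((1 - c * w) * U c * V c))"
  proof -
    have "u * Q / (Q * z) = u * w" for u using Q z0 zw by (simp add: field_simps)
    moreover have "Q / (Q * z)\<^sup>2 = w\<^sup>2 / Q"
      using Q z0 by (simp add: w_def z_def field_simps power2_eq_square)
    ultimately show ?thesis
      unfolding shift_kernel_def Q_def[symmetric]
      by (simp add: shifted_num uw) (simp add: U_def mult_ac)
  qed
  have weight: "cdqH_weight q a b c \<theta> = (1 - z\<^sup>2) * (1 - w\<^sup>2) * (M * N) /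
      (((1 - a * z) * (1 - a * w) * U a * V a) * ((1 - b * z) * (1 - b * w) * U b * V b) *
       ((1 - c * z) * (1 - c * w) * U c * V c))"
    unfolding cdqH_weight_cis z_def[symmetric] over_z uz uw z_sq
    by (simp add: w_sq mult_ac)
  have cos: "2 * of_real (cos \<theta>) = z + w"
    by (simp add: z_def w_def complex_eq_iff flip: cis_inverse inverse_eq_divide)
  have poly_id: "z * (1 - z\<^sup>2) * ((1 - a * w) * (1 - b * w) * (1 - c * w)) +
      w * (1 - w\<^sup>2) * ((1 - a * z) * (1 - b * z) * (1 - c * z)) =
      (z + w - (a + b + c) + a * b * c) * ((1 - z\<^sup>2) * (1 - w\<^sup>2))"
    unfolding w_def z_def[symmetric] using z0 by (simp add: divide_simps) algebra
  define X Y P where "X = (1 - a * z) * (1 - b * z) * (1 - c * z)"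
    and "Y = (1 - a * w) * (1 - b * w) * (1 - c * w)"
    and "P = U a * V a * (U b * V b) * (U c * V c)"
  have nz: "X \<noteq> 0" "Y \<noteq> 0" "P \<noteq> 0"
    using uz_nz UV_nz abc by (auto simp: X_def Y_def P_def)
  have "shift_kernel a b c z - shift_kernel a b c (Q * z) =
      z * (1 - z\<^sup>2) * (M * N) / (X * P) + w * (1 - w\<^sup>2) * (M * N) / (Y * P)"
    unfolding at_z at_Qz by (simp add: X_def Y_def P_def mult_ac)
  also have "\<dots> = (z * (1 - z\<^sup>2) * Y + w * (1 - w\<^sup>2) * X) * (M * N) / (X * Y * P)"
    using nz by (simp add: field_simps)
  also have "\<dots> = (z + w - (a + b + c) + a * b * c) * ((1 - z\<^sup>2) * (1 - w\<^sup>2)) * (M * N) / (X * Y * P)"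
    unfolding X_def Y_def poly_id ..
  also have "\<dots> = (z + w - (a + b + c) + a * b * c) * cdqH_weight q a b c \<theta>"
    unfolding weight by (simp add: X_def Y_def P_def mult_ac)
  finally show ?thesis unfolding cos by (simp add: z_def Q_def)
qed

text \<open>Cauchy's theorem: \<open>shift_kernel a b c z / z\<close> is holomorphic near the annulus between the circles
\<open>|z| = q\<close> and \<open>|z| = 1\<close>, since its singularities other than \<open>0\<close> are among \<open>uq\<^sup>k\<^sup>+\<^sup>1\<close> and
\<open>u\<^sup>-\<^sup>1q\<^sup>-\<^sup>k\<close> with \<open>u\<close> one of the three parameters.\<close>

lemma integral_shift_kernel:
  assumes abc: "norm a < 1" "norm b < 1" "norm c < 1"
  shows "integral {-pi..pi} (\<lambda>\<theta>. shift_kernel a b c (cis \<theta>)) =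
    integral {-pi..pi} (\<lambda>\<theta>. shift_kernel a b c (of_real q * cis \<theta>))"
    and "(\<lambda>\<theta>. shift_kernel a b c (cis \<theta>)) integrable_on {-pi..pi}"
    and "(\<lambda>\<theta>. shift_kernel a b c (of_real q * cis \<theta>)) integrable_on {-pi..pi}"
proof -
  define S where "S = {z::complex. z \<noteq> 0 \<and> (\<forall>u\<in>{a, b, c}. norm (u * of_real q) < norm z \<and> norm (u * z) < 1)}"
  have "S = {z. z \<noteq> 0} \<inter> (\<Inter>u\<in>{a,b,c}. {z. norm (u * of_real q) < norm z} \<inter> {z. norm (u * z) < 1})"
    by (auto simp: S_def)
  also have "open \<dots>"
    by (intro open_Int open_INT ballI open_Collect_less open_Collect_neq continuous_intros) auto
  finally have "open S" .
  have holo: "shift_kernel a b c holomorphic_on S"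
    unfolding shift_kernel_def
    by (intro holomorphic_intros) (auto simp: S_def norm_divide qpoch_inf_nonzero)
  then have holo': "(\<lambda>z. shift_kernel a b c z / z) holomorphic_on S"
    by (intro holomorphic_intros) (auto simp: S_def)
  have annulus: "of_real r * cis \<theta> \<in> S" if "q \<le> r" "r \<le> 1" for r \<theta>
  proof -
    have "norm u * q < r \<and> norm u * r < 1" if "u \<in> {a, b, c}" for u
    proof -
      have "norm u < 1" using that abc by auto
      then have "norm u * q < q" "norm u * r \<le> norm u"
        using \<open>q \<le> r\<close> \<open>r \<le> 1\<close> q_pos by (auto intro: mult_left_le)
      then show ?thesis using \<open>norm u < 1\<close> \<open>q \<le> r\<close> by linarith
    qed
    then show ?thesis using that q_pos by (auto simp: S_def norm_mult)
  qed
  have on_circle: "continuous_on {-pi..pi} (\<lambda>\<theta>. shift_kernel a b c (of_real r * cis \<theta>))"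
    if "q \<le> r" "r \<le> 1" for r
    using annulus[OF that]
    by (intro continuous_on_compose2[OF holomorphic_on_imp_continuous_on[OF holo]] continuous_intros)
       auto
  show "(\<lambda>\<theta>. shift_kernel a b c (cis \<theta>)) integrable_on {-pi..pi}"
    and "(\<lambda>\<theta>. shift_kernel a b c (of_real q * cis \<theta>)) integrable_on {-pi..pi}"
    using on_circle[of 1] on_circle[of q] q_pos q_less_1
    by (auto intro!: integrable_continuous_real)
  let ?C = "\<lambda>r. part_circlepath 0 r (- pi) pi"
  have loop: "pathfinish (?C r) = pathstart (?C r)" for r
    by (simp add: exp_minus)
  have "homotopic_loops S (?C 1) (?C q)"
  proof (rule homotopic_loops_linear)
    fix t :: real
    show "closed_segment (?C 1 t) (?C q t) \<subseteq> S"
    proof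
      fix x assume "x \<in> closed_segment (?C 1 t) (?C q t)"
      then obtain s where s: "0 \<le> s" "s \<le> 1" and x: "x = (1 - s) *\<^sub>R ?C 1 t + s *\<^sub>R ?C q t"
        by (auto simp: closed_segment_def)
      have "x = of_real (1 - s * (1 - q)) * cis (linepath (- pi) pi t)"
        unfolding x part_circlepath_def by (simp add: cis_conv_exp scaleR_conv_of_real algebra_simps)
      moreover have "q \<le> 1 - s * (1 - q)" "1 - s * (1 - q) \<le> 1"
        using s q_less_1 mult_left_le_one_le[of "1 - q" s] mult_nonneg_nonneg[of s "1 - q"]
        by linarith+
      ultimately show "x \<in> S" by (simp only: annulus)
    qed
  qed (simp_all add: loop exp_minus)
  then have "contour_integral (?C 1) (\<lambda>z. shift_kernel a b c z / z) =
      contour_integral (?C q) (\<lambda>z. shift_kernel a b c z / z)"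
    by (rule Cauchy_theorem_homotopic_loops) (simp_all add: \<open>open S\<close> holo')
  then show "integral {-pi..pi} (\<lambda>\<theta>. shift_kernel a b c (cis \<theta>)) =
    integral {-pi..pi} (\<lambda>\<theta>. shift_kernel a b c (of_real q * cis \<theta>))"
    using q_pos by (simp add: contour_integral_part_circlepath_eq field_simps)
qed

end

lemma integral_even:
  fixes f :: "real \<Rightarrow> complex"
  assumes f: "continuous_on {-m..m} f" and m: "0 \<le> m" and even: "\<And>x. f (- x) = f x"
  shows "integral {-m..m} f = 2 *\<^sub>R integral {0..m} f"
proof -
  have "integral {-m..m} f = integral {-m..0} f + integral {0..m} f"
    using Henstock_Kurzweil_Integration.integral_combine[of "-m" 0 m f] integrable_continuous_real[OF f] m
    by simp
  also have "integral {-m..0} f = integral {0..m} f"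
    using Henstock_Kurzweil_Integration.integral_reflect_real[of m 0 f] even by simp
  finally show ?thesis by (simp add: scaleR_2)
qed

text \<open>The substitution \<open>x = cos \<theta>\<close>. The integrand on the left may be singular at the endpoints, so the
fundamental theorem is used in the version that asks for a derivative in the interior only; the
primitive is a primitive of \<open>f\<close> composed with \<open>arccos\<close>.\<close>

lemma has_integral_arccos:
  fixes f :: "real \<Rightarrow> complex"
  assumes f: "continuous_on {0..pi} f"
  shows "((\<lambda>x. f (arccos x) / of_real (sqrt (1 - x\<^sup>2))) has_integral integral {0..pi} f) {-1..1}"
proof -
  define F where "F \<theta> = integral {0..\<theta>} f" for \<theta>
  have cont_F: "continuous_on {0..pi} F"
    unfolding F_def by (intro indefinite_integral_continuous_1 integrable_continuous_real f)
  have "((\<lambda>x. f (arccos x) / of_real (sqrt (1 - x\<^sup>2))) has_integral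
      (- F (arccos 1) - - F (arccos (-1)))) {-1..1}"
  proof (rule fundamental_theorem_of_calculus_interior)
    show "continuous_on {-1..1} (\<lambda>x. - F (arccos x))"
      by (intro continuous_intros continuous_on_compose2[OF cont_F] continuous_on_arccos')
        (auto intro: arccos_lbound arccos_ubound)
  next
    fix x :: real assume x: "x \<in> {-1<..<1}"
    have "arccos x \<in> {0<..<pi}" using x arccos_lt_bounded by auto
    then have "(F has_vector_derivative f (arccos x)) (at (arccos x))"
      using integral_has_vector_derivative[OF f, of "arccos x"]
      unfolding F_def by (simp add: at_within_Icc_at)
    moreover have "(arccos has_vector_derivative inverse (- sqrt (1 - x\<^sup>2))) (at x)"
      unfolding has_real_derivative_iff_has_vector_derivative[symmetric]
      using x by (intro DERIV_arccos) auto
    ultimately have "((F \<circ> arccos) has_vector_derivative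
        inverse (- sqrt (1 - x\<^sup>2)) *\<^sub>R f (arccos x)) (at x)"
      by (intro vector_diff_chain_at)
    then show "((\<lambda>x. - F (arccos x)) has_vector_derivative
        f (arccos x) / of_real (sqrt (1 - x\<^sup>2))) (at x)"
      using has_vector_derivative_minus
      by (fastforce simp: o_def scaleR_conv_of_real divide_inverse mult.commute)
  qed simp
  then show ?thesis by (simp add: F_def)
qed

context q_base
begin

definition cdqH_functional :: "complex \<Rightarrow> complex \<Rightarrow> complex \<Rightarrow> complex poly \<Rightarrow> complex" where
  "cdqH_functional a b c p =
    integral {0..pi} (\<lambda>\<theta>. poly p (of_real (cos \<theta>)) * cdqH_weight q a b c \<theta>)"

lemma continuous_on_cdqH_integrand:
  assumes "norm a < 1" "norm b < 1" "norm c < 1"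
  shows "continuous_on X (\<lambda>\<theta>. poly p (of_real (cos \<theta>)) * cdqH_weight q a b c \<theta>)"
  using assms by (intro continuous_intros)

lemma cdqH_functional_add:
  assumes "norm a < 1" "norm b < 1" "norm c < 1"
  shows "cdqH_functional a b c (p + p') = cdqH_functional a b c p + cdqH_functional a b c p'"
  unfolding cdqH_functional_def poly_add distrib_right
  by (intro integral_add integrable_continuous_real continuous_on_cdqH_integrand assms)

lemma cdqH_functional_smult:
  "cdqH_functional a b c (smult s p) = s * cdqH_functional a b c p"
  unfolding cdqH_functional_def poly_smult mult.assoc by (rule integral_mult_right)

lemma cdqH_functional_0 [simp]: "cdqH_functional a b c 0 = 0"
  by (simp add: cdqH_functional_def)

lemma cdqH_functional_sum:
  assumes "norm a < 1" "norm b < 1" "norm c < 1"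
  shows "cdqH_functional a b c (\<Sum>k\<in>I. f k) = (\<Sum>k\<in>I. cdqH_functional a b c (f k))"
  by (induction I rule: infinite_finite_induct) (simp_all add: cdqH_functional_add[OF assms])

text \<open>The difference of the two kernels in \<open>shift_kernel_diff\<close> integrates to \<open>0\<close> over a full period, and it
is even in \<open>\<theta>\<close>.\<close>

lemma cdqH_first_moment:
  assumes abc: "norm a < 1" "norm b < 1" "norm c < 1"
  shows "cdqH_functional a b c [: a * b * c - (a + b + c), 2 :] = 0"
proof -
  let ?f = "\<lambda>\<theta>. poly [: a * b * c - (a + b + c), 2 :] (of_real (cos \<theta>)) * cdqH_weight q a b c \<theta>"
  have "2 *\<^sub>R integral {0..pi} ?f = integral {-pi..pi} ?f"
    by (rule integral_even[symmetric, OF continuous_on_cdqH_integrand[OF abc]])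
      (auto simp: cdqH_weight_even)
  also have "\<dots> = integral {-pi..pi}
      (\<lambda>\<theta>. shift_kernel a b c (cis \<theta>) - shift_kernel a b c (of_real q * cis \<theta>))"
    unfolding shift_kernel_diff[OF abc] by (simp add: algebra_simps)
  also have "\<dots> = 0"
    using integral_shift_kernel[OF abc] by (simp add: integral_diff)
  finally show ?thesis by (simp add: cdqH_functional_def)
qed

section \<open>The total mass of the weight\<close>

definition cdqH_mass :: "complex \<Rightarrow> complex \<Rightarrow> complex \<Rightarrow> complex" where
  "cdqH_mass a b c = cdqH_functional a b c 1"

lemma cdqH_mass_swap12: "cdqH_mass a b c = cdqH_mass b a c"
  unfolding cdqH_mass_def cdqH_functional_def by (subst cdqH_weight_swap12) simp

lemma cdqH_mass_swap13: "cdqH_mass a b c = cdqH_mass c b a"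
  unfolding cdqH_mass_def cdqH_functional_def by (subst cdqH_weight_swap13) simp

text \<open>Passing from \<open>a\<close> to \<open>aq\<close> multiplies the weight by \<open>1 + a\<^sup>2 - 2a cos \<theta>\<close>, so the new mass is a
combination of the old mass and the first moment.\<close>

lemma cdqH_mass_shift:
  assumes abc: "norm a < 1" "norm b < 1" "norm c < 1"
  shows "cdqH_mass (a * of_real q) b c = (1 - a * b) * (1 - a * c) * cdqH_mass a b c"
proof -
  let ?p = "[: 1 + a\<^sup>2, - 2 * a :]"
  have p: "?p = smult ((1 - a * b) * (1 - a * c)) 1 + smult (- a) [: a * b * c - (a + b + c), 2 :]"
    by (simp add: algebra_simps power2_eq_square one_pCons)
  have "cdqH_mass (a * of_real q) b c = cdqH_functional a b c ?p"
    unfolding cdqH_mass_def cdqH_functional_def cdqH_weight_shift[OF abc(1)]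
    by (simp add: algebra_simps)
  then show ?thesis
    unfolding p cdqH_functional_add[OF abc] cdqH_functional_smult cdqH_first_moment[OF abc]
    by (simp add: cdqH_mass_def)
qed

lemma cdqH_mass_shift_iter:
  assumes abc: "norm a < 1" "norm b < 1" "norm c < 1"
  shows "cdqH_mass (a * of_real q ^ k) b c = qpoch (a * b) q k * qpoch (a * c) q k * cdqH_mass a b c"
proof (induction k)
  case (Suc k)
  then show ?case
    using cdqH_mass_shift[OF norm_mult_q_power_less_1[OF abc(1), of k] abc(2,3)]
    by (simp add: qpoch_Suc mult_ac)
qed simp

text \<open>If the mass vanished, it would vanish at \<open>(aq\<^sup>N, bq\<^sup>N, cq\<^sup>N)\<close> for every \<open>N\<close> by the functional equation,
hence at \<open>(0,0,0)\<close> by continuity. But the weight with zero parameters is \<open>|(e\<^sup>2\<^sup>i\<^sup>\<theta>;q)\<^sub>\<infinity>|\<^sup>2\<close>, which is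
nonnegative and positive at \<open>\<theta> = \<pi>/2\<close>.\<close>

lemma cdqH_mass_nonzero:
  assumes abc: "norm a < 1" "norm b < 1" "norm c < 1"
  shows "cdqH_mass a b c \<noteq> 0"
proof
  assume zero: "cdqH_mass a b c = 0"
  note less = norm_mult_q_power_less_1
  define J where "J t = cdqH_mass (a * of_real t) (b * of_real t) (c * of_real t)" for t
  have J_zero: "J (q ^ N) = 0" for N
  proof -
    have "cdqH_mass (a * of_real q ^ N) b c = 0"
      using cdqH_mass_shift_iter[OF abc] zero by simp
    then have "cdqH_mass b (a * of_real q ^ N) c = 0" by (subst cdqH_mass_swap12)
    then have "cdqH_mass (b * of_real q ^ N) (a * of_real q ^ N) c = 0"
      using cdqH_mass_shift_iter[OF abc(2) less[OF abc(1)] abc(3)] by simp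
    then have "cdqH_mass c (a * of_real q ^ N) (b * of_real q ^ N) = 0"
      by (subst cdqH_mass_swap13)
    then have "cdqH_mass (c * of_real q ^ N) (a * of_real q ^ N) (b * of_real q ^ N) = 0"
      using cdqH_mass_shift_iter[OF abc(3) less[OF abc(1)] less[OF abc(2)]] by simp
    then show ?thesis
      unfolding J_def of_real_power by (metis cdqH_mass_swap12 cdqH_mass_swap13)
  qed
  have small: "norm (u * of_real t) < 1" if "t \<in> {0..1}" "norm u < 1" for t :: real and u :: complex
    using that mult_left_le[of t "norm u"] by (auto simp: norm_mult)
  have "continuous_on {0..1} (\<lambda>t. integral (cbox 0 pi)
      (\<lambda>\<theta>. poly 1 (of_real (cos \<theta>)) *
        cdqH_weight q (a * of_real t) (b * of_real t) (c * of_real t) \<theta>))"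
    unfolding split_beta
    by (intro integral_continuous_on_param) (auto simp: split_beta intro!: continuous_intros small abc)
  then have "continuous_on {0..1} J"
    by (simp add: J_def[abs_def] cdqH_mass_def cdqH_functional_def)
  moreover have "(\<lambda>N. q ^ N) \<longlonglongrightarrow> 0"
    using q_pos q_less_1 by (intro LIMSEQ_power_zero) auto
  ultimately have "(\<lambda>N. J (q ^ N)) \<longlonglongrightarrow> J 0"
    using q_pos q_less_1
    by (intro continuous_on_tendsto_compose[of "{0..1}" J]) (auto simp: power_le_one)
  then have "J 0 = 0" by (simp add: J_zero LIMSEQ_const_iff)
  define g where "g \<theta> = (norm (qpoch_inf ((cis \<theta>)\<^sup>2) q))\<^sup>2" for \<theta>
  have weight_0: "cdqH_weight q 0 0 0 \<theta> = of_real (g \<theta>)" for \<theta>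
  proof -
    have "cnj (qpoch z q k) = qpoch (cnj z) q k" for z k
      by (simp add: qpoch_def)
    then have "(\<lambda>k. cnj (qpoch z q k)) \<longlonglongrightarrow> qpoch_inf (cnj z) q" for z
      using qpoch_tendsto_inf by simp
    then have "cnj (qpoch_inf z q) = qpoch_inf (cnj z) q" for z
      using LIMSEQ_unique[OF tendsto_cnj[OF qpoch_tendsto_inf]] by blast
    then have "qpoch_inf (1 / (cis \<theta>)\<^sup>2) q = cnj (qpoch_inf ((cis \<theta>)\<^sup>2) q)"
      by (simp add: cis_cnj flip: inverse_eq_divide power_inverse)
    then show ?thesis
      unfolding cdqH_weight_cis g_def by (simp add: complex_norm_square del: of_real_power)
  qed
  have cont_g: "continuous_on X g" for X
    unfolding g_def by (intro continuous_intros)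
  have "of_real (integral {0..pi} g) = J 0"
    unfolding J_def cdqH_mass_def cdqH_functional_def
    using integral_linear[OF integrable_continuous_real[OF cont_g]
        bounded_linear_of_real[where 'a = complex], of 0 pi]
    by (simp add: weight_0 o_def)
  then have "integral {0..pi} g = 0" using \<open>J 0 = 0\<close> by simp
  then have "\<And>\<theta>. \<theta> \<in> {0..pi} \<Longrightarrow> g \<theta> = 0"
    using integral_eq_0_iff[OF cont_g[of "{0..pi}"]] by (simp add: g_def)
  then have "g (pi / 2) = 0" by simp
  then have "qpoch_inf (- 1) q = 0" by (simp add: g_def)
  moreover have "1 - (- 1) * of_real q ^ j \<noteq> (0 :: complex)" for j
  proof -
    have "1 + q ^ j \<noteq> 0" using q_pos by (smt (verit) zero_less_power)
    then have "complex_of_real (1 + q ^ j) \<noteq> 0" unfolding of_real_eq_0_iff .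
    then show ?thesis by simp
  qed
  ultimately show False
    using prodinf_nonzero[OF convergent_prod_qpoch[of "-1"]] unfolding qpoch_inf_def by blast
qed

lemma cdqH_weight_shift_iter:
  assumes "norm a < 1"
  shows "cdqH_weight q (a * of_real q ^ l) b c \<theta> =
    poly (qbasis q a l) (of_real (cos \<theta>)) * cdqH_weight q a b c \<theta>"
proof (induction l)
  case (Suc l)
  have "cdqH_weight q (a * of_real q ^ Suc l) b c \<theta> =
      (1 + (a * of_real q ^ l)\<^sup>2 - 2 * (a * of_real q ^ l) * of_real (cos \<theta>)) *
      cdqH_weight q (a * of_real q ^ l) b c \<theta>"
    using cdqH_weight_shift[OF norm_mult_q_power_less_1[OF assms, of l]] by (simp add: mult_ac)
  also have "(1 + (a * of_real q ^ l)\<^sup>2 - 2 * (a * of_real q ^ l) * of_real (cos \<theta>)) =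
      poly [: 1 + a\<^sup>2 * of_real q ^ (2 * l), - 2 * a * of_real q ^ l :] (of_real (cos \<theta>))"
    by (simp add: power_mult_distrib mult_ac flip: power_mult)
  finally show ?case unfolding Suc qbasis_def prod.lessThan_Suc poly_mult by (simp only: mult_ac)
qed (simp add: qbasis_def)

text \<open>The two products of linear factors turn the weight into the weight with parameters
\<open>aq\<^sup>l, bq\<^sup>k, c\<close>. Since \<open>(bc;q)\<^sub>k\<close> splits off and \<open>(ab;q)\<^sub>k\<^sub>+\<^sub>l\<close> can be split from either end,
the dependence on \<open>k\<close> is \<open>(bc;q)\<^sub>k (abq\<^sup>l;q)\<^sub>k\<close>. The first factor is the denominator in \<open>T\<close>, the
second one is what the little q-Laguerre weight produces.\<close>

lemma cdqH_functional_qbasis_mult: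
  assumes abc: "norm a < 1" "norm b < 1" "norm c < 1"
  shows "cdqH_functional a b c (qbasis q b k * qbasis q a l) =
    qpoch (b * c) q k * qpoch (a * b * of_real q ^ l) q k *
    (qpoch (a * b) q l * qpoch (a * c) q l * cdqH_mass a b c)"
proof -
  have "cdqH_weight q (a * of_real q ^ l) (b * of_real q ^ k) c \<theta> =
      poly (qbasis q b k * qbasis q a l) (of_real (cos \<theta>)) * cdqH_weight q a b c \<theta>" for \<theta>
    unfolding cdqH_weight_shift_iter[OF abc(1)] cdqH_weight_swap12[of a "b * _"]
      cdqH_weight_shift_iter[OF abc(2)] cdqH_weight_swap12[of b a] by simp
  then have "cdqH_functional a b c (qbasis q b k * qbasis q a l) =
      cdqH_mass (a * of_real q ^ l) (b * of_real q ^ k) c"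
    unfolding cdqH_mass_def cdqH_functional_def by simp
  also have "\<dots> = qpoch (a * (b * of_real q ^ k)) q l * qpoch (a * c) q l *
      (qpoch (b * a) q k * qpoch (b * c) q k * cdqH_mass a b c)"
    unfolding cdqH_mass_shift_iter[OF abc(1) norm_mult_q_power_less_1[OF abc(2)] abc(3)]
      cdqH_mass_swap12[of a "b * _"] cdqH_mass_shift_iter[OF abc(2,1,3)] cdqH_mass_swap12[of b a] ..
  also have "qpoch (a * (b * of_real q ^ k)) q l * qpoch (a * c) q l *
      (qpoch (b * a) q k * qpoch (b * c) q k * cdqH_mass a b c) =
      (qpoch (a * b) q k * qpoch (a * b * of_real q ^ k) q l) *
      (qpoch (a * c) q l * qpoch (b * c) q k * cdqH_mass a b c)"
    by (simp add: mult_ac)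
  also have "qpoch (a * b) q k * qpoch (a * b * of_real q ^ k) q l =
      qpoch (a * b) q l * qpoch (a * b * of_real q ^ l) q k"
    unfolding qpoch_add[symmetric] by (simp add: add.commute)
  finally show ?thesis by (simp add: mult_ac)
qed

end

section \<open>Changes between graded bases of polynomials\<close>

definition graded :: "(nat \<Rightarrow> 'a::field poly) \<Rightarrow> bool" where
  "graded e \<longleftrightarrow> (\<forall>k. e k \<noteq> 0 \<and> degree (e k) = k)"

text \<open>Both \<open>T\<close> and the transform \<open>x\<^sup>k \<mapsto> (y;q)\<^sub>k\<close> have this form, with one polynomial \<open>e k\<close> of
each degree \<open>k\<close>. So both are bijective and preserve degrees for the same reason.\<close>

definition basis_change :: "(nat \<Rightarrow> 'a::field poly) \<Rightarrow> 'a poly \<Rightarrow> 'a poly" where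
  "basis_change e p = (\<Sum>k\<le>degree p. smult (coeff p k) (e k))"

lemma basis_change_bound:
  assumes "degree p \<le> N"
  shows "basis_change e p = (\<Sum>k\<le>N. smult (coeff p k) (e k))"
  unfolding basis_change_def using assms
  by (intro sum.mono_neutral_left) (auto simp: coeff_eq_0)

lemma basis_change_add: "basis_change e (p + p') = basis_change e p + basis_change e p'"
proof -
  let ?N = "max (degree p) (degree p')"
  have "degree (p + p') \<le> ?N" by (rule degree_add_le) auto
  then show ?thesis
    by (simp add: basis_change_bound[of _ ?N] smult_add_left sum.distrib)
qed

lemma basis_change_smult: "basis_change e (smult s p) = smult s (basis_change e p)"
proof -
  have "smult s (\<Sum>k\<in>A. f k) = (\<Sum>k\<in>A. smult s (f k))" for A and f :: "nat \<Rightarrow> 'a poly"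
    by (induction A rule: infinite_finite_induct) (auto simp: smult_add_right)
  then show ?thesis
    by (simp add: basis_change_bound[of "smult s p" "degree p"] basis_change_bound[of p "degree p"])
qed

lemma basis_change_0 [simp]: "basis_change e 0 = 0"
  by (simp add: basis_change_def)

lemma basis_change_sum: "basis_change e (\<Sum>i\<in>I. f i) = (\<Sum>i\<in>I. basis_change e (f i))"
  by (induction I rule: infinite_finite_induct) (simp_all add: basis_change_add)

lemma basis_change_monom: "basis_change e (monom s k) = smult s (e k)"
proof -
  have "basis_change e (monom s k) = (\<Sum>i\<le>k. if i = k then smult s (e k) else 0)"
    unfolding basis_change_bound[OF degree_monom_le] by (rule sum.cong) auto
  then show ?thesis by simp
qed

lemma degree_basis_change:
  assumes "graded e"
  shows "degree (basis_change e p) = degree p"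
proof (cases "p = 0")
  case False
  let ?n = "degree p"
  have "degree (basis_change e p) \<le> ?n"
    unfolding basis_change_def by (rule degree_sum_le) (use assms in \<open>auto simp: graded_def\<close>)
  moreover have "coeff (basis_change e p) ?n \<noteq> 0"
  proof -
    have "coeff (basis_change e p) ?n = (\<Sum>k\<le>?n. coeff p k * coeff (e k) ?n)"
      by (simp add: basis_change_def coeff_sum)
    also have "\<dots> = (\<Sum>k\<le>?n. if k = ?n then lead_coeff p * lead_coeff (e ?n) else 0)"
      using assms by (intro sum.cong) (auto simp: graded_def coeff_eq_0)
    finally show ?thesis
      using assms False leading_coeff_neq_0[of "e ?n"] by (auto simp: graded_def)
  qed
  ultimately show ?thesis using le_degree by fastforce
qed simp

lemma basis_change_eq_0_iff:
  assumes "graded e"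
  shows "basis_change e p = 0 \<longleftrightarrow> p = 0"
proof
  assume eq: "basis_change e p = 0"
  then have "degree p = 0" using degree_basis_change[OF assms, of p] by simp
  then obtain s where s: "p = monom s 0" by (metis monom_0 degree_eq_zeroE)
  have "e 0 \<noteq> 0" using assms by (simp add: graded_def)
  then show "p = 0" using eq unfolding s basis_change_monom by simp
qed simp

lemma basis_change_inject:
  assumes "graded e"
  shows "basis_change e p = basis_change e p' \<longleftrightarrow> p = p'"
proof -
  have "basis_change e (p - p') = basis_change e p - basis_change e p'"
    using basis_change_add[of e "p - p'" p'] by simp
  then show ?thesis using basis_change_eq_0_iff[OF assms, of "p - p'"] by auto
qed

lemma basis_change_surj:
  assumes "graded e"
  shows "\<exists>p. basis_change e p = f"
proof (induction "degree f" arbitrary: f rule: less_induct)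
  case less
  show ?case
  proof (cases "degree f = 0")
    case True
    then obtain s where s: "f = [:s:]" by (metis degree_eq_zeroE)
    have "e 0 \<noteq> 0" "degree (e 0) = 0" using assms by (auto simp: graded_def)
    then obtain t where t: "e 0 = [:t:]" "t \<noteq> 0" by (metis degree_eq_zeroE pCons_0_0)
    then have "basis_change e (monom (s / t) 0) = f"
      unfolding basis_change_monom by (simp add: s)
    then show ?thesis by blast
  next
    case False
    let ?n = "degree f"
    have e: "degree (e ?n) = ?n" "lead_coeff (e ?n) \<noteq> 0"
      using assms leading_coeff_neq_0 unfolding graded_def by blast+
    let ?s = "lead_coeff f / lead_coeff (e ?n)"
    have "degree (f - smult ?s (e ?n)) \<le> ?n - 1"
    proof (rule degree_le, intro allI impI)
      fix i assume "?n - 1 < i"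
      then show "coeff (f - smult ?s (e ?n)) i = 0"
        using e by (cases "i = ?n") (auto simp: coeff_eq_0)
    qed
    then have "degree (f - smult ?s (e ?n)) < ?n" using False by simp
    then obtain p where "basis_change e p = f - smult ?s (e ?n)"
      using less by blast
    then have "basis_change e (p + monom ?s ?n) = f"
      by (simp add: basis_change_add basis_change_monom)
    then show ?thesis by blast
  qed
qed

text \<open>Any two graded families have the same span up to each degree, so the test functions \<open>x\<^sup>l\<close> of the
orthogonality conditions may be replaced by products adapted to the weight.\<close>

lemma linear_vanishes_on_graded:
  fixes \<Lambda> :: "'a::field poly \<Rightarrow> 'a"
  assumes add: "\<And>f g. \<Lambda> (f + g) = \<Lambda> f + \<Lambda> g" and smult: "\<And>s f. \<Lambda> (smult s f) = s * \<Lambda> f"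
    and "graded e" "graded e'" and vanish: "\<And>l. l < n \<Longrightarrow> \<Lambda> (e l) = 0" and "l < n"
  shows "\<Lambda> (e' l) = 0"
proof -
  obtain p where p: "basis_change e p = e' l" using basis_change_surj[OF \<open>graded e\<close>] by blast
  have "degree p = l"
    using degree_basis_change[OF \<open>graded e\<close>, of p] \<open>graded e'\<close> by (simp add: p graded_def)
  have zero: "\<Lambda> 0 = 0" using smult[of 0 0] by simp
  have sum: "\<Lambda> (\<Sum>i\<in>I. f i) = (\<Sum>i\<in>I. \<Lambda> (f i))" for I :: "nat set" and f
    by (induction I rule: infinite_finite_induct) (simp_all add: add zero)
  have "\<Lambda> (e' l) = (\<Sum>i\<le>l. coeff p i * \<Lambda> (e i))"
    unfolding p[symmetric] basis_change_def \<open>degree p = l\<close> sum smult ..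
  also have "\<dots> = 0" using vanish \<open>l < n\<close> by (intro sum.neutral) auto
  finally show ?thesis .
qed

lemma graded_monom: "graded (\<lambda>k. monom 1 k)"
  by (simp add: graded_def degree_monom_eq)

lemma graded_prod_linear:
  fixes f :: "nat \<Rightarrow> 'a::field poly"
  assumes "\<And>j. degree (f j) = 1"
  shows "graded (\<lambda>k. \<Prod>j<k. f j)"
proof -
  have nz: "f j \<noteq> 0" for j using assms[of j] by auto
  then have "degree (\<Prod>j<k. f j) = k" for k
    by (subst degree_prod_eq_sum_degree) (auto simp: assms)
  then show ?thesis using nz by (simp add: graded_def)
qed

lemma graded_smult:
  assumes "graded e" "\<And>k. s k \<noteq> 0"
  shows "graded (\<lambda>k. smult (s k) (e k))"
  using assms by (simp add: graded_def)

section \<open>Orthogonality as vanishing of a transform\<close>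

context q_base
begin

lemma graded_qbasis: "b \<noteq> 0 \<Longrightarrow> graded (qbasis q b)"
  using graded_prod_linear[of "\<lambda>j. [: 1 + b\<^sup>2 * of_real q ^ (2 * j), - 2 * b * of_real q ^ j :]"] q_pos
  by (simp add: qbasis_def[abs_def])

definition qpoch_poly :: "nat \<Rightarrow> complex poly" where
  "qpoch_poly k = (\<Prod>j<k. [: 1, - (of_real q ^ j) :])"

lemma poly_qpoch_poly: "poly (qpoch_poly k) y = qpoch y q k"
  by (simp add: qpoch_poly_def qpoch_def poly_prod)

lemma graded_qpoch_poly: "graded qpoch_poly"
  using graded_prod_linear[of "\<lambda>j. [: 1, - (of_real q ^ j) :] :: complex poly"] q_pos
  by (simp add: qpoch_poly_def[abs_def])

definition qpoch_transform :: "complex poly \<Rightarrow> complex poly" where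
  "qpoch_transform = basis_change qpoch_poly"

lemma poly_qpoch_transform:
  "poly (qpoch_transform p) y = (\<Sum>k\<le>degree p. coeff p k * qpoch y q k)"
  by (simp add: qpoch_transform_def basis_change_def poly_sum poly_qpoch_poly)

text \<open>All \<open>(1;q)\<^sub>k\<close> with \<open>k > 0\<close> vanish, so the normalization at \<open>0\<close> becomes a normalization at \<open>1\<close>.\<close>

lemma poly_qpoch_transform_1: "poly (qpoch_transform p) 1 = poly p 0"
proof -
  have "qpoch 1 q k = (if k = 0 then 1 else 0)" for k
    by (cases k) (auto simp: qpoch_Suc_left)
  then have "poly (qpoch_transform p) 1 = (\<Sum>k\<le>degree p. if k = 0 then coeff p 0 else 0)"
    unfolding poly_qpoch_transform by (intro sum.cong) auto
  then show ?thesis by (simp add: poly_0_coeff_0)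
qed

text \<open>Termwise, \<open>x\<^sup>i\<close> contributes the q-exponential series at \<open>yq\<^sup>i\<close>, and
\<open>1/(yq\<^sup>i;q)\<^sub>\<infinity> = (y;q)\<^sub>i/(y;q)\<^sub>\<infinity>\<close>.\<close>

lemma little_qLaguerre_moment_sums:
  assumes y: "norm y < 1"
  shows "(\<lambda>k. poly p (of_real q ^ k) * (y ^ k / qpoch (of_real q) q k)) sums
    (poly (qpoch_transform p) y / qpoch_inf y q)"
proof -
  have "(\<lambda>k. \<Sum>i\<le>degree p. coeff p i * ((y * of_real q ^ i) ^ k / qpoch (of_real q) q k)) sums
      (\<Sum>i\<le>degree p. coeff p i * (1 / qpoch_inf (y * of_real q ^ i) q))"
    by (intro sums_sum sums_mult q_exponential_sums norm_mult_q_power_less_1 y)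
  also have "(\<lambda>k. \<Sum>i\<le>degree p. coeff p i * ((y * of_real q ^ i) ^ k / qpoch (of_real q) q k)) =
      (\<lambda>k. poly p (of_real q ^ k) * (y ^ k / qpoch (of_real q) q k))"
    by (simp add: poly_altdef sum_distrib_left sum_divide_distrib power_mult_distrib mult_ac
        flip: power_mult)
  also have "(\<Sum>i\<le>degree p. coeff p i * (1 / qpoch_inf (y * of_real q ^ i) q)) =
      poly (qpoch_transform p) y / qpoch_inf y q"
  proof -
    have "1 / qpoch_inf (y * of_real q ^ i) q = qpoch y q i / qpoch_inf y q" for i
      using qpoch_inf_split[of y i] qpoch_inf_nonzero[OF y] by (simp add: divide_simps)
    then show ?thesis by (simp add: poly_qpoch_transform sum_divide_distrib)
  qed
  finally show ?thesis .
qed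

lemma little_qLaguerre_orthogonal_iff:
  assumes "norm (A * of_real q) < 1"
  shows "(\<lambda>k. poly p (of_real q ^ k) * of_real q ^ (k * l) *
      ((A * of_real q) ^ k / qpoch (of_real q) q k)) sums 0 \<longleftrightarrow>
    poly (qpoch_transform p) (A * of_real q * of_real q ^ l) = 0"
proof -
  let ?y = "A * of_real q * of_real q ^ l"
  have y: "norm ?y < 1" by (rule norm_mult_q_power_less_1[OF assms])
  have "(\<lambda>k. poly p (of_real q ^ k) * of_real q ^ (k * l) *
      ((A * of_real q) ^ k / qpoch (of_real q) q k)) =
    (\<lambda>k. poly p (of_real q ^ k) * (?y ^ k / qpoch (of_real q) q k))"
    by (simp add: power_mult_distrib mult_ac flip: power_mult)
  then show ?thesis
    using little_qLaguerre_moment_sums[OF y, of p] qpoch_inf_nonzero[OF y] sums_unique2 by fastforce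
qed

definition cdqH_basis :: "complex \<Rightarrow> complex \<Rightarrow> nat \<Rightarrow> complex poly" where
  "cdqH_basis b c k = smult (1 / qpoch (b * c) q k) (qbasis q b k)"

lemma T_op_eq: "T_op q b c = basis_change (cdqH_basis b c)"
  by (rule ext) (simp add: T_op_def basis_change_def cdqH_basis_def)

lemma graded_cdqH_basis:
  assumes "b \<noteq> 0" "norm b < 1" "norm c < 1"
  shows "graded (cdqH_basis b c)"
  unfolding cdqH_basis_def[abs_def]
  by (intro graded_smult graded_qbasis assms) (simp add: qpoch_nonzero norm_prod_less_1 assms)

text \<open>The counterpart of \<open>little_qLaguerre_moment_sums\<close>: the same transform, at the same points, now
computes the integrals of \<open>T(p)\<close>, up to a factor that does not depend on \<open>p\<close>.\<close>

lemma cdqH_functional_T_op: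
  assumes abc: "norm a < 1" "norm b < 1" "norm c < 1"
  shows "cdqH_functional a b c (T_op q b c p * qbasis q a l) =
    poly (qpoch_transform p) (a * b * of_real q ^ l) *
    (qpoch (a * b) q l * qpoch (a * c) q l * cdqH_mass a b c)"
proof -
  let ?K = "qpoch (a * b) q l * qpoch (a * c) q l * cdqH_mass a b c"
  have "cdqH_functional a b c (T_op q b c p * qbasis q a l) =
      (\<Sum>k\<le>degree p. coeff p k / qpoch (b * c) q k *
        cdqH_functional a b c (qbasis q b k * qbasis q a l))"
    unfolding T_op_def sum_distrib_right mult_smult_left
    by (simp only: cdqH_functional_sum[OF abc] cdqH_functional_smult)
  also have "\<dots> = (\<Sum>k\<le>degree p. coeff p k * qpoch (a * b * of_real q ^ l) q k * ?K)"
  proof (intro sum.cong refl)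
    fix k
    have "qpoch (b * c) q k \<noteq> 0" by (intro qpoch_nonzero norm_prod_less_1 abc)
    then show "coeff p k / qpoch (b * c) q k *
        cdqH_functional a b c (qbasis q b k * qbasis q a l) =
      coeff p k * qpoch (a * b * of_real q ^ l) q k * ?K"
      unfolding cdqH_functional_qbasis_mult[OF abc] by simp
  qed
  finally show ?thesis by (simp only: poly_qpoch_transform sum_distrib_right)
qed

lemma cdqH_has_integral_0_iff:
  assumes abc: "norm a < 1" "norm b < 1" "norm c < 1"
  shows "((\<lambda>x::real. poly p (of_real x) * of_real x ^ l * cdqH_weight q a b c (arccos x)
      / of_real (sqrt (1 - x\<^sup>2))) has_integral 0) {-1..1} \<longleftrightarrow>
    cdqH_functional a b c (p * monom 1 l) = 0"
proof -
  let ?g = "\<lambda>\<theta>. poly (p * monom 1 l) (of_real (cos \<theta>)) * cdqH_weight q a b c \<theta>"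
  let ?f = "\<lambda>x::real. poly p (of_real x) * of_real x ^ l * cdqH_weight q a b c (arccos x)
      / of_real (sqrt (1 - x\<^sup>2))"
  have "((\<lambda>x. ?g (arccos x) / of_real (sqrt (1 - x\<^sup>2))) has_integral
      cdqH_functional a b c (p * monom 1 l)) {-1..1}"
    unfolding cdqH_functional_def
    by (rule has_integral_arccos, rule continuous_on_cdqH_integrand[OF abc])
  then have "(?f has_integral cdqH_functional a b c (p * monom 1 l)) {-1..1}"
    by (rule has_integral_eq[rotated]) (simp add: poly_monom)
  then show ?thesis using has_integral_unique by auto
qed

text \<open>The factors in \<open>cdqH_functional_T_op\<close> are nonzero, and since \<open>a \<noteq> 0\<close> the test functions \<open>x\<^sup>l\<close> may be
exchanged for the products \<open>(ae\<^sup>i\<^sup>\<theta>,ae\<^sup>-\<^sup>i\<^sup>\<theta>;q)\<^sub>l\<close>.\<close>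

lemma cdqH_orthogonal_T_op_iff:
  assumes abc: "norm a < 1" "norm b < 1" "norm c < 1" and "a \<noteq> 0"
  shows "(\<forall>l<n. ((\<lambda>x::real. poly (T_op q b c p) (of_real x) * of_real x ^ l *
      cdqH_weight q a b c (arccos x) / of_real (sqrt (1 - x\<^sup>2))) has_integral 0) {-1..1}) \<longleftrightarrow>
    (\<forall>l<n. poly (qpoch_transform p) (a * b * of_real q ^ l) = 0)"
proof -
  let ?L = "\<lambda>f. cdqH_functional a b c (T_op q b c p * f)"
  have add: "?L (f + g) = ?L f + ?L g" for f g
    by (simp only: distrib_left cdqH_functional_add[OF abc])
  have smult: "?L (smult s f) = s * ?L f" for s f
    by (simp only: mult_smult_right cdqH_functional_smult)
  note change = linear_vanishes_on_graded[of ?L, OF add smult]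
  have "(\<forall>l<n. ?L (monom 1 l) = 0) \<longleftrightarrow> (\<forall>l<n. ?L (qbasis q a l) = 0)"
    using change[OF graded_monom graded_qbasis[OF \<open>a \<noteq> 0\<close>]]
      change[OF graded_qbasis[OF \<open>a \<noteq> 0\<close>] graded_monom] by metis
  then show ?thesis
    using qpoch_nonzero[OF norm_prod_less_1[OF abc(1,2)]]
      qpoch_nonzero[OF norm_prod_less_1[OF abc(1,3)]] cdqH_mass_nonzero[OF abc]
    by (simp add: cdqH_has_integral_0_iff[OF abc] cdqH_functional_T_op[OF abc])
qed

section \<open>Polynomials vanishing on geometric progressions\<close>

text \<open>Every linear factor is scaled to be \<open>1\<close> at \<open>1\<close>, which is where the normalization at \<open>0\<close> of a little
q-Laguerre polynomial shows in its transform.\<close>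

definition node_poly :: "nat \<Rightarrow> (nat \<Rightarrow> nat) \<Rightarrow> (nat \<Rightarrow> complex) \<Rightarrow> complex poly" where
  "node_poly r n B = (\<Prod>j=1..r. \<Prod>l<n j.
    smult (1 / (1 - B j * of_real q ^ l)) [: - (B j * of_real q ^ l), 1 :])"

lemma poly_node_poly:
  "poly (node_poly r n B) y =
    (\<Prod>j=1..r. \<Prod>l<n j. (y - B j * of_real q ^ l) / (1 - B j * of_real q ^ l))"
  by (simp add: node_poly_def poly_prod diff_divide_distrib)

lemma node_poly_1:
  assumes "\<And>j. j \<in> {1..r} \<Longrightarrow> norm (B j) < 1"
  shows "poly (node_poly r n B) 1 = 1"
  unfolding poly_node_poly
  using one_minus_q_power_nonzero[OF assms] by (intro prod.neutral ballI) simp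

lemma degree_node_poly:
  assumes "\<And>j. j \<in> {1..r} \<Longrightarrow> norm (B j) < 1"
  shows "degree (node_poly r n B) = (\<Sum>j=1..r. n j)"
proof -
  let ?f = "\<lambda>j l. smult (1 / (1 - B j * of_real q ^ l)) [: - (B j * of_real q ^ l), 1 :]"
  have f: "?f j l \<noteq> 0 \<and> degree (?f j l) = 1" if "j \<in> {1..r}" for j l
    using one_minus_q_power_nonzero[OF assms[OF that], of l] by simp
  have "degree (\<Prod>l<n j. ?f j l) = n j" if "j \<in> {1..r}" for j
    using f[OF that] by (subst degree_prod_eq_sum_degree) auto
  then show ?thesis
    unfolding node_poly_def using f
    by (subst degree_prod_eq_sum_degree) (auto simp del: smult_pCons smult_eq_0_iff simp: prod_zero_iff)
qed

lemma node_poly_vanishes: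
  assumes "j \<in> {1..r}" "l < n j"
  shows "poly (node_poly r n B) (B j * of_real q ^ l) = 0"
proof -
  have "(\<Prod>i<n j. (B j * of_real q ^ l - B j * of_real q ^ i) / (1 - B j * of_real q ^ i)) = 0"
    using assms(2) by (intro prod_zero bexI[of _ l]) auto
  then show ?thesis
    unfolding poly_node_poly by (rule prod_zero[OF finite_atLeastAtMost bexI[OF _ assms(1)]])
qed

text \<open>The two sides have degree at most \<open>|n|\<close> and agree at \<open>|n| + 1\<close> points: the zeros \<open>B\<^sub>j q\<^sup>l\<close>,
distinct by the ratio condition, and the point \<open>1\<close>, which lies outside the open unit disc that
contains these zeros.\<close>

lemma eq_smult_node_poly:
  assumes B: "\<And>j. j \<in> {1..r} \<Longrightarrow> norm (B j) < 1" "\<And>j. j \<in> {1..r} \<Longrightarrow> B j \<noteq> 0"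
    and ratio: "\<And>i j (m::int). i \<in> {1..r} \<Longrightarrow> j \<in> {1..r} \<Longrightarrow> i \<noteq> j \<Longrightarrow>
      B i / B j \<noteq> of_real q powi m"
    and deg: "degree f \<le> (\<Sum>j=1..r. n j)"
    and vanish: "\<And>j l. j \<in> {1..r} \<Longrightarrow> l < n j \<Longrightarrow> poly f (B j * of_real q ^ l) = 0"
  shows "f = smult (poly f 1) (node_poly r n B)"
proof -
  define node where "node = (\<lambda>(j, l). B j * of_real q ^ l)"
  define I where "I = (SIGMA j:{1..r}. {..<n j})"
  have q0: "complex_of_real q \<noteq> 0" using q_pos by simp
  have "inj_on node I"
  proof (rule inj_onI, clarify)
    fix i l j m assume "(i, l) \<in> I" "(j, m) \<in> I" and eq: "node (i, l) = node (j, m)"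
    then have ij: "i \<in> {1..r}" "j \<in> {1..r}" by (auto simp: I_def)
    have eq: "B i * of_real q ^ l = B j * of_real q ^ m" using eq by (simp add: node_def)
    have "i = j"
    proof (rule ccontr)
      have "B i / B j = of_real q ^ m / of_real q ^ l"
        using eq B(2)[OF ij(2)] q0 by (simp add: field_simps)
      also have "\<dots> = of_real q powi (int m - int l)"
        using q0 by (simp add: power_int_diff)
      finally show "i \<noteq> j \<Longrightarrow> False" using ratio[OF ij] by blast
    qed
    moreover have "l = m"
    proof -
      have "complex_of_real (q ^ l) = complex_of_real (q ^ m)"
        using eq B(2)[OF ij(2)] \<open>i = j\<close> by simp
      then have "q ^ l = q ^ m" unfolding of_real_eq_iff .
      then show ?thesis using q_pos q_less_1 by (simp add: power_inject_exp')
    qed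
    ultimately show "i = j \<and> l = m" ..
  qed
  then have "card (node ` I) = (\<Sum>j=1..r. n j)"
    by (simp add: card_image I_def card_SigmaI)
  moreover have "1 \<notin> node ` I"
  proof
    assume "1 \<in> node ` I"
    then obtain j l where "j \<in> {1..r}" "1 = B j * of_real q ^ l"
      by (auto simp: node_def I_def)
    then show False
      using norm_mult_q_power_less_1[OF B(1), of j l] by (metis less_irrefl norm_one)
  qed
  moreover have "finite I" by (simp add: I_def)
  ultimately have card: "card (insert 1 (node ` I)) = Suc (\<Sum>j=1..r. n j)" by simp
  show ?thesis
  proof (rule poly_eqI_degree)
    show "poly f x = poly (smult (poly f 1) (node_poly r n B)) x" if "x \<in> insert 1 (node ` I)" for x
      using that vanish node_poly_vanishes node_poly_1[OF B(1)] by (auto simp: node_def I_def)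
    show "degree f < card (insert 1 (node ` I))" using card deg by simp
    show "degree (smult (poly f 1) (node_poly r n B)) < card (insert 1 (node ` I))"
      using card degree_node_poly[OF B(1)] degree_smult_le[of "poly f 1" "node_poly r n B"] by simp
  qed
qed

text \<open>The transform is a bijection on polynomials, so this gives existence and uniqueness at once.\<close>

lemma is_multiple_little_qLaguerre_iff:
  assumes "\<And>j. j \<in> {1..r} \<Longrightarrow> norm (A j * of_real q) < 1" "\<And>j. j \<in> {1..r} \<Longrightarrow> A j \<noteq> 0"
    and ratio: "\<And>i j (m::int). i \<in> {1..r} \<Longrightarrow> j \<in> {1..r} \<Longrightarrow> i \<noteq> j \<Longrightarrow>
      A i / A j \<noteq> of_real q powi m"
  shows "is_multiple_little_qLaguerre q r n A p \<longleftrightarrow>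
    qpoch_transform p = node_poly r n (\<lambda>j. A j * of_real q)"
proof -
  let ?B = "\<lambda>j. A j * of_real q"
  have B: "norm (?B j) < 1" "?B j \<noteq> 0" if "j \<in> {1..r}" for j
    using assms(1,2)[OF that] q_pos by auto
  have B_ratio: "?B i / ?B j \<noteq> of_real q powi m" if "i \<in> {1..r}" "j \<in> {1..r}" "i \<noteq> j" for i j m
    using ratio[OF that] q_pos by simp
  have iff: "is_multiple_little_qLaguerre q r n A p \<longleftrightarrow>
      degree (qpoch_transform p) = (\<Sum>j=1..r. n j) \<and> poly (qpoch_transform p) 1 = 1 \<and>
      (\<forall>j\<in>{1..r}. \<forall>l<n j. poly (qpoch_transform p) (?B j * of_real q ^ l) = 0)"
    unfolding is_multiple_little_qLaguerre_def poly_qpoch_transform_1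
    by (simp only: qpoch_transform_def degree_basis_change[OF graded_qpoch_poly]
        little_qLaguerre_orthogonal_iff[OF assms(1), unfolded qpoch_transform_def] cong: ball_cong)
  show ?thesis
  proof
    assume "is_multiple_little_qLaguerre q r n A p"
    then show "qpoch_transform p = node_poly r n ?B"
      unfolding iff using eq_smult_node_poly[OF B B_ratio, where f = "qpoch_transform p" and n = n] by auto
  next
    assume p: "qpoch_transform p = node_poly r n ?B"
    show "is_multiple_little_qLaguerre q r n A p"
      unfolding iff p
      by (intro conjI ballI allI impI degree_node_poly node_poly_1
          node_poly_vanishes[where B = ?B] B(1))
  qed
qed

lemma qpoch_transform_multiple_little_qLaguerre:
  assumes "\<And>j. j \<in> {1..r} \<Longrightarrow> norm (A j * of_real q) < 1" "\<And>j. j \<in> {1..r} \<Longrightarrow> A j \<noteq> 0"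
    and "\<And>i j (m::int). i \<in> {1..r} \<Longrightarrow> j \<in> {1..r} \<Longrightarrow> i \<noteq> j \<Longrightarrow>
      A i / A j \<noteq> of_real q powi m"
  shows "qpoch_transform (multiple_little_qLaguerre q r n A) =
    node_poly r n (\<lambda>j. A j * of_real q)"
proof -
  obtain p where p: "qpoch_transform p = node_poly r n (\<lambda>j. A j * of_real q)"
    unfolding qpoch_transform_def using basis_change_surj[OF graded_qpoch_poly] by blast
  have iff: "is_multiple_little_qLaguerre q r n A f \<longleftrightarrow>
      qpoch_transform f = node_poly r n (\<lambda>j. A j * of_real q)" for f
    by (rule is_multiple_little_qLaguerre_iff[OF assms])
  have "multiple_little_qLaguerre q r n A = p"
    unfolding multiple_little_qLaguerre_def
    unfolding iff p[symmetric] qpoch_transform_def basis_change_inject[OF graded_qpoch_poly]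
    by (rule the_equality) auto
  then show ?thesis using p by simp
qed

section \<open>The q-Chu-Vandermonde sum and its multiple version\<close>

text \<open>The coefficients of the \<open>\<^sub>2\<phi>\<^sub>1\<close> series with parameters \<open>u, y; B\<close> and argument \<open>q\<close>, without the
factor \<open>(y;q)\<^sub>k\<close>. It terminates for \<open>u = q\<^sup>-\<^sup>n\<close>.\<close>

definition chu_coeff :: "complex \<Rightarrow> complex \<Rightarrow> nat \<Rightarrow> complex" where
  "chu_coeff u B k = qpoch u q k * of_real q ^ k / (qpoch (of_real q) q k * qpoch B q k)"

lemma chu_coeff_0 [simp]: "chu_coeff u B 0 = 1"
  by (simp add: chu_coeff_def)

text \<open>The coefficients for \<open>n\<close> and \<open>n + 1\<close> (\<open>u = q\<^sup>-\<^sup>n\<^sup>-\<^sup>1\<close>) are related as multiplication by \<open>y - Bq\<^sup>n\<close>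
in the basis \<open>(y;q)\<^sub>k\<close> demands. With \<open>u\<close> kept general, no factor has to be divided out that is zero
where the series terminates.\<close>

lemma chu_coeff_rec:
  assumes "u \<noteq> 0" "norm B < 1"
  shows "chu_coeff u B (Suc m) * (1 - B / (u * of_real q)) =
    chu_coeff (u * of_real q) B (Suc m) * (1 / of_real q ^ Suc m - B / (u * of_real q)) -
    chu_coeff (u * of_real q) B m / of_real q ^ m"
proof -
  define Q t D where "Q = complex_of_real q" and "t = Q ^ m" and "D = qpoch (u * Q) q m"
  define E where "E = qpoch Q q m * qpoch B q m"
  have Q: "Q \<noteq> 0" "t \<noteq> 0" using q_pos by (auto simp: Q_def t_def)
  have nz: "E \<noteq> 0" "1 - Q * t \<noteq> 0" "1 - B * t \<noteq> 0"
    using q_pos q_less_1 qpoch_nonzero[of B m] qpoch_q_nonzero[of m] assms(2)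
      one_minus_q_power_nonzero[of "of_real q" m] one_minus_q_power_nonzero[of B m]
    by (auto simp: E_def Q_def t_def)
  have "chu_coeff u B (Suc m) = (1 - u) * D * (Q * t) / (E * (1 - Q * t) * (1 - B * t))"
    unfolding chu_coeff_def qpoch_Suc_left[of u]
    by (simp add: qpoch_Suc mult_ac flip: Q_def t_def D_def E_def)
      (simp add: D_def t_def E_def Q_def mult_ac)
  moreover have "chu_coeff (u * Q) B (Suc m) =
      D * (1 - u * Q * t) * (Q * t) / (E * (1 - Q * t) * (1 - B * t))"
    unfolding chu_coeff_def by (simp add: D_def t_def E_def Q_def mult_ac qpoch_Suc)
  moreover have "chu_coeff (u * Q) B m = D * t / E"
    unfolding chu_coeff_def by (simp add: D_def t_def E_def Q_def mult_ac)
  moreover have "Q ^ Suc m = Q * t" by (simp add: t_def)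
  moreover have "(1 - u) * D * (Q * t) / (E * (1 - Q * t) * (1 - B * t)) * (1 - B / (u * Q)) =
      D * (1 - u * Q * t) * (Q * t) / (E * (1 - Q * t) * (1 - B * t)) * (1 / (Q * t) - B / (u * Q)) -
      D * t / E / t"
  proof -
    define p where "p = Q * t"
    have "p \<noteq> 0" using Q by (simp add: p_def)
    have "(1 - u) * p * (1 - B / (u * Q)) =
        (1 - u * p) * p * (1 / p - B / (u * Q)) - (1 - p) * (1 - B * t)"
      using Q \<open>p \<noteq> 0\<close> assms(1) by (simp add: divide_simps) (simp add: p_def algebra_simps)
    then have "D / (E * (1 - p) * (1 - B * t)) * ((1 - u) * p * (1 - B / (u * Q))) =
        D / (E * (1 - p) * (1 - B * t)) * ((1 - u * p) * p * (1 / p - B / (u * Q))) -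
        D / (E * (1 - p) * (1 - B * t)) * ((1 - p) * (1 - B * t))"
      by (simp only: right_diff_distrib)
    also have "D / (E * (1 - p) * (1 - B * t)) * ((1 - p) * (1 - B * t)) = D / E"
      using nz by (simp add: p_def)
    finally show ?thesis using Q by (simp add: p_def mult_ac)
  qed
  ultimately show ?thesis by (simp only: Q_def[symmetric] t_def[symmetric])
qed

lemma qpoch_neg_power_vanish:
  "qpoch (of_real q powi (- int n)) q (Suc n) = 0"
proof -
  have "of_real q powi (- int n) * of_real q ^ n = (1 :: complex)"
    using q_pos by (simp add: power_int_minus)
  then show ?thesis by (simp add: qpoch_Suc)
qed

text \<open>By induction on \<open>n\<close>: multiplying the sum by \<open>y - Bq\<^sup>n\<close> and using
\<open>y (y;q)\<^sub>k = q\<^sup>-\<^sup>k ((y;q)\<^sub>k - (y;q)\<^sub>k\<^sub>+\<^sub>1)\<close> gives \<open>1 - Bq\<^sup>n\<close> times the sum for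
\<open>n + 1\<close>, by the recurrence of the coefficients.\<close>

lemma q_Chu_Vandermonde:
  assumes B: "norm B < 1"
  shows "(\<Sum>k\<le>n. chu_coeff (of_real q powi (- int n)) B k * qpoch y q k) =
    (\<Prod>l<n. (y - B * of_real q ^ l) / (1 - B * of_real q ^ l))"
proof (induction n)
  case (Suc n)
  define Q where "Q = complex_of_real q"
  define u where "u = Q powi (- int (Suc n))"
  have Q: "Q \<noteq> 0" using q_pos by (simp add: Q_def)
  have Q_neg: "Q powi (- int m) = inverse (Q ^ m)" for m
    by (simp add: power_int_minus)
  have u: "u \<noteq> 0" "u * Q = Q powi (- int n)" "B / (u * Q) = B * Q ^ n"
    unfolding u_def Q_neg using Q by (simp_all add: field_simps)
  let ?c = "chu_coeff u B" and ?d = "chu_coeff (u * Q) B"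
  \<comment> \<open>The series for \<open>n\<close> may be summed up to \<open>n + 1\<close>, which aligns the two index ranges.\<close>
  have d_vanish: "?d (Suc n) = 0"
    using qpoch_neg_power_vanish[of n] unfolding u(2) by (simp add: chu_coeff_def Q_def)
  have nz: "1 - B * Q ^ n \<noteq> 0" using one_minus_q_power_nonzero[OF B, of n] by (simp add: Q_def)
  have raise: "y * qpoch y q k = (qpoch y q k - qpoch y q (Suc k)) / Q ^ k" for k
    using Q by (simp add: qpoch_Suc Q_def field_simps)
  have c_rec: "?c (Suc m) * (1 - B * Q ^ n) =
      ?d (Suc m) * (1 / Q ^ Suc m - B * Q ^ n) - ?d m / Q ^ m" for m
    using chu_coeff_rec[OF u(1) B, of m] unfolding Q_def[symmetric] u(3) .
  have "(\<Sum>k\<le>Suc n. ?c k * qpoch y q k) * (1 - B * Q ^ n) =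
      (\<Sum>k\<le>Suc n. ?c k * (1 - B * Q ^ n) * qpoch y q k)"
    unfolding sum_distrib_right by (intro sum.cong refl) (simp only: mult_ac)
  also have "\<dots> = (1 - B * Q ^ n) +
      (\<Sum>m\<le>n. (?d (Suc m) * (1 / Q ^ Suc m - B * Q ^ n) - ?d m / Q ^ m) * qpoch y q (Suc m))"
    unfolding sum.atMost_Suc_shift c_rec by simp
  also have "\<dots> = (\<Sum>k\<le>Suc n. ?d k * (1 / Q ^ k - B * Q ^ n) * qpoch y q k) -
      (\<Sum>k\<le>n. ?d k / Q ^ k * qpoch y q (Suc k))"
    unfolding sum.atMost_Suc_shift by (simp add: left_diff_distrib sum_subtractf)
  also have "\<dots> = (\<Sum>k\<le>n. ?d k * (1 / Q ^ k - B * Q ^ n) * qpoch y q k) -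
      (\<Sum>k\<le>n. ?d k / Q ^ k * qpoch y q (Suc k))"
    by (simp add: d_vanish)
  also have "\<dots> = (\<Sum>k\<le>n. ?d k * (y * qpoch y q k) - B * Q ^ n * (?d k * qpoch y q k))"
    unfolding raise sum_subtractf[symmetric]
    by (intro sum.cong refl) (simp add: field_simps diff_divide_distrib)
  also have "\<dots> = (y - B * Q ^ n) * (\<Sum>k\<le>n. ?d k * qpoch y q k)"
    unfolding sum_distrib_left by (intro sum.cong refl) (simp add: algebra_simps)
  also have "(\<Sum>k\<le>n. ?d k * qpoch y q k) = (\<Prod>l<n. (y - B * Q ^ l) / (1 - B * Q ^ l))"
    using Suc unfolding u(2)[unfolded Q_def] Q_def .
  finally have "(\<Sum>k\<le>Suc n. ?c k * qpoch y q k) =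
      (\<Prod>l<n. (y - B * Q ^ l) / (1 - B * Q ^ l)) * ((y - B * Q ^ n) / (1 - B * Q ^ n))"
    using nz by (simp add: nonzero_eq_divide_eq mult_ac)
  then show ?case by (simp add: u_def Q_def)
qed simp

text \<open>The factors of the multiple sum that involve \<open>n\<^sub>j\<close> and \<open>k = k\<^sub>j\<close>; \<open>K\<close> stands for
\<open>k\<^sub>j\<^sub>+\<^sub>1 + \<dots> + k\<^sub>r\<close>. For \<open>j = r\<close> this is \<open>0\<close> and the middle quotient is \<open>1\<close>, so the product over
\<open>j < r\<close> in the theorem may be extended to \<open>j = r\<close>.\<close>

definition component_coeff :: "nat \<Rightarrow> complex \<Rightarrow> nat \<Rightarrow> nat \<Rightarrow> complex" where
  "component_coeff n B k K =
    qpoch (of_real q powi (- int n)) q k / (qpoch (of_real q) q k * qpoch B q k) *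
    (qpoch (B * of_real q ^ n) q K / qpoch (B * of_real q ^ k) q K) *
    (of_real q ^ k / of_real q ^ (n * K))"

text \<open>Splitting off \<open>(y;q)\<^sub>K/(B;q)\<^sub>K\<close> leaves a q-Chu-Vandermonde sum with \<open>y\<close> and \<open>B\<close> replaced by \<open>yq\<^sup>K\<close> and
\<open>Bq\<^sup>K\<close>. The factors with \<open>n\<close> and \<open>K\<close> in \<open>component_coeff\<close> are there to cancel the dependence of its value on
\<open>K\<close>, so that only \<open>(y;q)\<^sub>K\<close> remains, which is the summand for the other components.\<close>

lemma sum_component_coeff:
  assumes B: "norm B < 1"
  shows "(\<Sum>k=0..n. component_coeff n B k K * qpoch y q (k + K)) =
    (\<Prod>l<n. (y - B * of_real q ^ l) / (1 - B * of_real q ^ l)) * qpoch y q K"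
proof -
  define Q where "Q = complex_of_real q"
  have Q: "Q \<noteq> 0" using q_pos by (simp add: Q_def)
  have BK: "norm (B * Q ^ K) < 1" unfolding Q_def by (rule norm_mult_q_power_less_1[OF B])
  have nz: "qpoch (B * Q ^ j) q i \<noteq> 0" for i j
    unfolding Q_def by (intro qpoch_nonzero norm_mult_q_power_less_1 B)
  have "component_coeff n B k K * qpoch y q (k + K) =
      qpoch (B * Q ^ n) q K / Q ^ (n * K) * qpoch y q K / qpoch B q K *
      (chu_coeff (Q powi (- int n)) (B * Q ^ K) k * qpoch (y * Q ^ K) q k)" for k
  proof -
    have "qpoch B q k * qpoch (B * Q ^ k) q K = qpoch B q K * qpoch (B * Q ^ K) q k"
      unfolding Q_def qpoch_add[symmetric] by (simp add: add.commute)
    moreover have "qpoch y q (k + K) = qpoch y q K * qpoch (y * Q ^ K) q k"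
      unfolding Q_def qpoch_add[symmetric] by (simp add: add.commute)
    moreover have "component_coeff n B k K = qpoch (Q powi (- int n)) q k * Q ^ k *
        qpoch (B * Q ^ n) q K /
        (qpoch Q q k * (qpoch B q k * qpoch (B * Q ^ k) q K) * Q ^ (n * K))"
      by (simp add: component_coeff_def Q_def mult_ac)
    ultimately show ?thesis
      by (simp add: chu_coeff_def mult_ac flip: Q_def)
  qed
  then have "(\<Sum>k=0..n. component_coeff n B k K * qpoch y q (k + K)) =
      qpoch (B * Q ^ n) q K / Q ^ (n * K) * qpoch y q K / qpoch B q K *
      (\<Prod>l<n. (y * Q ^ K - B * Q ^ K * Q ^ l) / (1 - B * Q ^ K * Q ^ l))"
    unfolding atMost_atLeast0[symmetric] Q_def q_Chu_Vandermonde[OF BK[unfolded Q_def], symmetric]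
    by (simp only: sum_distrib_left)
  also have "(\<Prod>l<n. (y * Q ^ K - B * Q ^ K * Q ^ l) / (1 - B * Q ^ K * Q ^ l)) =
      Q ^ (n * K) * (\<Prod>l<n. y - B * Q ^ l) / qpoch (B * Q ^ K) q n"
  proof -
    have "(\<Prod>l<n. y * Q ^ K - B * Q ^ K * Q ^ l) = (\<Prod>l<n. Q ^ K * (y - B * Q ^ l))"
      by (simp add: algebra_simps)
    also have "\<dots> = Q ^ (n * K) * (\<Prod>l<n. y - B * Q ^ l)"
      by (simp add: prod.distrib power_mult mult.commute)
    finally show ?thesis by (simp add: prod_dividef qpoch_def Q_def)
  qed
  also have "qpoch (B * Q ^ n) q K / Q ^ (n * K) * qpoch y q K / qpoch B q K *
      (Q ^ (n * K) * (\<Prod>l<n. y - B * Q ^ l) / qpoch (B * Q ^ K) q n) =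
      qpoch (B * Q ^ n) q K * qpoch y q K * (\<Prod>l<n. y - B * Q ^ l) /
      (qpoch B q K * qpoch (B * Q ^ K) q n)"
    using Q by simp
  also have "qpoch B q K * qpoch (B * Q ^ K) q n = qpoch B q n * qpoch (B * Q ^ n) q K"
    unfolding Q_def qpoch_add[symmetric] by (simp add: add.commute)
  also have "qpoch (B * Q ^ n) q K * qpoch y q K * (\<Prod>l<n. y - B * Q ^ l) /
      (qpoch B q n * qpoch (B * Q ^ n) q K) =
      (\<Prod>l<n. y - B * Q ^ l) / qpoch B q n * qpoch y q K"
    using nz by simp
  also have "(\<Prod>l<n. y - B * Q ^ l) / qpoch B q n = (\<Prod>l<n. (y - B * Q ^ l) / (1 - B * Q ^ l))"
    by (simp add: prod_dividef qpoch_def Q_def)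
  finally show ?thesis by (simp add: Q_def)
qed

text \<open>By downward induction on the first component \<open>s\<close>: the sum over \<open>k\<^sub>s\<close> is done first, for fixed values
of the later indices.\<close>

lemma sum_multi_index:
  assumes "s \<le> Suc r" and B: "\<And>j. j \<in> {s..r} \<Longrightarrow> norm (B j) < 1"
  shows "(\<Sum>k\<in>(\<Pi>\<^sub>E j\<in>{s..r}. {0..n j}).
      (\<Prod>j=s..r. component_coeff (n j) (B j) (k j) (\<Sum>i=j+1..r. k i)) * qpoch y q (\<Sum>j=s..r. k j)) =
    (\<Prod>j=s..r. \<Prod>l<n j. (y - B j * of_real q ^ l) / (1 - B j * of_real q ^ l))"
  using assms
proof (induction s rule: inc_induct)
  case (step s)
  let ?R = "\<lambda>j. \<Prod>l<n j. (y - B j * of_real q ^ l) / (1 - B j * of_real q ^ l)"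
  define F where "F t k = (\<Prod>j=t..r. component_coeff (n j) (B j) (k j) (\<Sum>i=j+1..r. k i))"
    for t and k :: "nat \<Rightarrow> nat"
  have ivl: "{s..r} = insert s {Suc s..r}" using step.hyps by auto
  have upd: "F (Suc s) (g(s := x)) = F (Suc s) g" "(\<Sum>i=Suc s..r. (g(s := x)) i) = (\<Sum>i=Suc s..r. g i)"
    for g x
    unfolding F_def by (auto intro!: prod.cong sum.cong arg_cong2[where f = "component_coeff _ _"])
  \<comment> \<open>A multi-index on \<open>{s..r}\<close> is a multi-index \<open>g\<close> on \<open>{s+1..r}\<close> together with \<open>x = k\<^sub>s\<close>.\<close>
  have inj: "inj_on (\<lambda>(x, g). g(s := x)) ({0..n s} \<times> (\<Pi>\<^sub>E j\<in>{Suc s..r}. {0..n j}))"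
    by (rule inj_combinator) auto
  have "(\<Sum>k\<in>(\<Pi>\<^sub>E j\<in>{s..r}. {0..n j}). F s k * qpoch y q (\<Sum>j=s..r. k j)) =
      (\<Sum>(x, g)\<in>{0..n s} \<times> (\<Pi>\<^sub>E j\<in>{Suc s..r}. {0..n j}).
        F s (g(s := x)) * qpoch y q (\<Sum>j=s..r. (g(s := x)) j))"
    unfolding ivl PiE_insert_eq sum.reindex[OF inj] by (simp add: case_prod_unfold)
  also have "\<dots> = (\<Sum>(x, g)\<in>{0..n s} \<times> (\<Pi>\<^sub>E j\<in>{Suc s..r}. {0..n j}).
      F (Suc s) g * (component_coeff (n s) (B s) x (\<Sum>i=Suc s..r. g i) *
        qpoch y q (x + (\<Sum>i=Suc s..r. g i))))"
  proof (intro sum.cong refl, clarify)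
    fix x g
    have "F s (g(s := x)) = component_coeff (n s) (B s) x (\<Sum>i=Suc s..r. g i) * F (Suc s) g"
      unfolding F_def[of s] ivl using upd[of g x] by (simp add: F_def)
    moreover have "(\<Sum>j=s..r. (g(s := x)) j) = x + (\<Sum>i=Suc s..r. g i)"
      unfolding ivl using upd[of g x] by simp
    ultimately show "F s (g(s := x)) * qpoch y q (\<Sum>j=s..r. (g(s := x)) j) =
      F (Suc s) g * (component_coeff (n s) (B s) x (\<Sum>i=Suc s..r. g i) *
        qpoch y q (x + (\<Sum>i=Suc s..r. g i)))"
      by (simp only: mult_ac)
  qed
  also have "\<dots> = (\<Sum>g\<in>(\<Pi>\<^sub>E j\<in>{Suc s..r}. {0..n j}). F (Suc s) g *
      (\<Sum>x=0..n s. component_coeff (n s) (B s) x (\<Sum>i=Suc s..r. g i) *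
        qpoch y q (x + (\<Sum>i=Suc s..r. g i))))"
    unfolding sum.cartesian_product[symmetric] sum_distrib_left by (rule sum.swap)
  also have "\<dots> = (\<Sum>g\<in>(\<Pi>\<^sub>E j\<in>{Suc s..r}. {0..n j}).
      ?R s * (F (Suc s) g * qpoch y q (\<Sum>i=Suc s..r. g i)))"
  proof (intro sum.cong refl)
    have "norm (B s) < 1" using step.prems step.hyps by simp
    then show "F (Suc s) g * (\<Sum>x=0..n s. component_coeff (n s) (B s) x (\<Sum>i=Suc s..r. g i) *
        qpoch y q (x + (\<Sum>i=Suc s..r. g i))) =
      ?R s * (F (Suc s) g * qpoch y q (\<Sum>i=Suc s..r. g i))" for g
      by (subst sum_component_coeff) (simp_all only: mult_ac)
  qed
  also have "\<dots> = ?R s * (\<Prod>j=Suc s..r. ?R j)"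
    unfolding sum_distrib_left[symmetric] F_def using step.IH step.prems by simp
  also have "\<dots> = (\<Prod>j=s..r. ?R j)" unfolding ivl by simp
  finally show ?case unfolding F_def .
qed simp

text \<open>The transforms of the two sides agree, by \<open>sum_multi_index\<close>, and the transform is injective.\<close>

lemma eq_sum_component_monoms:
  assumes B: "\<And>j. j \<in> {1..r} \<Longrightarrow> norm (B j) < 1"
    and p: "qpoch_transform p = node_poly r n B"
  shows "p = (\<Sum>k\<in>(\<Pi>\<^sub>E j\<in>{1..r}. {0..n j}).
    monom (\<Prod>j=1..r. component_coeff (n j) (B j) (k j) (\<Sum>i=j+1..r. k i)) (\<Sum>j=1..r. k j))"
    (is "p = ?q")
proof -
  have "poly (qpoch_transform ?q) y = poly (qpoch_transform p) y" for y
    unfolding p poly_node_poly using sum_multi_index[of 1 r B n y] B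
    by (simp add: qpoch_transform_def basis_change_sum basis_change_monom poly_sum poly_qpoch_poly)
  then have "qpoch_transform ?q = qpoch_transform p" by (intro poly_ext)
  then show ?thesis by (simp only: qpoch_transform_def basis_change_inject[OF graded_qpoch_poly])
qed

end

section \<open>Multiple continuous dual q-Hahn polynomials\<close>

theorem theorem3p4:
  fixes q :: real and r :: nat and n :: "nat \<Rightarrow> nat"
    and a \<alpha> :: "nat \<Rightarrow> complex" and b c :: complex
  assumes q: "0 < q" "q < 1"
    and r: "r \<ge> 1"
    and a_less: "\<And>j. j \<in> {1..r} \<Longrightarrow> norm (a j) < 1"
    and bc_less: "norm b < 1" "norm c < 1"
    and b_nz: "b \<noteq> 0"
    and a_powr: "\<And>j. j \<in> {1..r} \<Longrightarrow> a j = of_real q powr \<alpha> j"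
    and a_ratio: "\<And>i j (m::int). i \<in> {1..r} \<Longrightarrow> j \<in> {1..r} \<Longrightarrow> i \<noteq> j \<Longrightarrow>
                    a i / a j \<noteq> of_real q powi m"
  shows "let P = T_op q b c (multiple_little_qLaguerre q r n (\<lambda>j. b / of_real q * a j)) in
    is_multiple_cdqH q r n a b c P \<and>
    (\<forall>p. is_multiple_cdqH q r n a b c p \<longrightarrow> (\<exists>s. p = smult s P)) \<and>
    (\<forall>\<theta>::real. poly P (of_real (cos \<theta>)) =
      (\<Sum>k\<in>(\<Pi>\<^sub>E j\<in>{1..r}. {0..n j}).
         (\<Prod>j=1..r. qpoch (of_real q powi (- int (n j))) q (k j) /
                     (qpoch (of_real q) q (k j) * qpoch (a j * b) q (k j))) *
         (\<Prod>j=1..r-1. qpoch (a j * b * of_real q ^ n j) q (\<Sum>i=j+1..r. k i) /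
                       qpoch (a j * b * of_real q ^ k j) q (\<Sum>i=j+1..r. k i)) *
         (of_real q ^ (\<Sum>j=1..r. k j) / of_real q ^ (\<Sum>j=1..r. n j * (\<Sum>i=j+1..r. k i))) *
         (qpoch (b * exp (\<i> * of_real \<theta>)) q (\<Sum>j=1..r. k j) *
          qpoch (b * exp (- \<i> * of_real \<theta>)) q (\<Sum>j=1..r. k j) /
          qpoch (b * c) q (\<Sum>j=1..r. k j))))"
proof -
  interpret q_base q by unfold_locales (use q in auto)
  define A B where "A = (\<lambda>j. b / of_real q * a j)" and "B = (\<lambda>j. a j * b)"
  define p where "p = multiple_little_qLaguerre q r n A"
  have q0: "complex_of_real q \<noteq> 0" using q by simp
  have Aq: "A j * of_real q = B j" for j
    using q0 by (simp add: A_def B_def)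
  have a_nz: "a j \<noteq> 0" if "j \<in> {1..r}" for j
    using a_powr[OF that] q0 by simp
  have B: "norm (B j) < 1" "B j \<noteq> 0" if "j \<in> {1..r}" for j
    using norm_prod_less_1[OF a_less[OF that] bc_less(1)] a_nz[OF that] b_nz by (auto simp: B_def)
  have A: "norm (A j * of_real q) < 1" "A j \<noteq> 0" if "j \<in> {1..r}" for j
    unfolding Aq using B[OF that] Aq[of j] by auto
  have ratio: "A i / A j \<noteq> of_real q powi m" "B i / B j \<noteq> of_real q powi m"
    if "i \<in> {1..r}" "j \<in> {1..r}" "i \<noteq> j" for i j m
    using a_ratio[OF that] b_nz q0 by (simp_all add: A_def B_def)
  have p: "qpoch_transform p = node_poly r n B"
    unfolding p_def using qpoch_transform_multiple_little_qLaguerre[OF A ratio(1)]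
    by (simp add: Aq)
  \<comment> \<open>Every polynomial is \<open>T(f)\<close> for some \<open>f\<close> because \<open>b \<noteq> 0\<close>; the conditions on \<open>T(f)\<close> are then conditions
  on the transform of \<open>f\<close>.\<close>
  note graded = graded_cdqH_basis[OF b_nz bc_less]
  have cdqH_iff: "is_multiple_cdqH q r n a b c (T_op q b c f) \<longleftrightarrow>
      degree (qpoch_transform f) = (\<Sum>j=1..r. n j) \<and>
      (\<forall>j\<in>{1..r}. \<forall>l<n j. poly (qpoch_transform f) (B j * of_real q ^ l) = 0)" for f
    unfolding is_multiple_cdqH_def
    using cdqH_orthogonal_T_op_iff[OF a_less bc_less a_nz]
    by (simp add: B_def T_op_eq qpoch_transform_def degree_basis_change graded graded_qpoch_poly)
  have "is_multiple_cdqH q r n a b c (T_op q b c p)"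
    unfolding cdqH_iff p using degree_node_poly[OF B(1)] node_poly_vanishes by simp
  moreover have "\<exists>s. f = smult s (T_op q b c p)" if f: "is_multiple_cdqH q r n a b c f" for f
  proof -
    obtain g where g: "f = T_op q b c g"
      unfolding T_op_eq using basis_change_surj[OF graded] by metis
    have "qpoch_transform g = smult (poly (qpoch_transform g) 1) (qpoch_transform p)"
      using f unfolding g cdqH_iff p by (intro eq_smult_node_poly B ratio(2)) auto
    then have "g = smult (poly (qpoch_transform g) 1) p"
      unfolding qpoch_transform_def basis_change_smult[symmetric]
        basis_change_inject[OF graded_qpoch_poly] .
    then show ?thesis unfolding g T_op_smult[symmetric] by metis
  qed
  moreover have "poly (T_op q b c p) (of_real (cos \<theta>)) =
      (\<Sum>k\<in>(\<Pi>\<^sub>E j\<in>{1..r}. {0..n j}).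
         (\<Prod>j=1..r. qpoch (of_real q powi (- int (n j))) q (k j) /
                     (qpoch (of_real q) q (k j) * qpoch (a j * b) q (k j))) *
         (\<Prod>j=1..r-1. qpoch (a j * b * of_real q ^ n j) q (\<Sum>i=j+1..r. k i) /
                       qpoch (a j * b * of_real q ^ k j) q (\<Sum>i=j+1..r. k i)) *
         (of_real q ^ (\<Sum>j=1..r. k j) / of_real q ^ (\<Sum>j=1..r. n j * (\<Sum>i=j+1..r. k i))) *
         (qpoch (b * exp (\<i> * of_real \<theta>)) q (\<Sum>j=1..r. k j) *
          qpoch (b * exp (- \<i> * of_real \<theta>)) q (\<Sum>j=1..r. k j) /
          qpoch (b * c) q (\<Sum>j=1..r. k j)))" for \<theta>
  proof -
    let ?coeff = "\<lambda>k. \<Prod>j=1..r. component_coeff (n j) (B j) (k j) (\<Sum>i=j+1..r. k i)"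
    have coeff: "?coeff k =
        (\<Prod>j=1..r. qpoch (of_real q powi (- int (n j))) q (k j) /
                    (qpoch (of_real q) q (k j) * qpoch (a j * b) q (k j))) *
        (\<Prod>j=1..r-1. qpoch (a j * b * of_real q ^ n j) q (\<Sum>i=j+1..r. k i) /
                      qpoch (a j * b * of_real q ^ k j) q (\<Sum>i=j+1..r. k i)) *
        (of_real q ^ (\<Sum>j=1..r. k j) / of_real q ^ (\<Sum>j=1..r. n j * (\<Sum>i=j+1..r. k i)))"
      for k :: "nat \<Rightarrow> nat"
    proof -
      let ?g = "\<lambda>j. qpoch (a j * b * of_real q ^ n j) q (\<Sum>i=j+1..r. k i) /
                      qpoch (a j * b * of_real q ^ k j) q (\<Sum>i=j+1..r. k i)"
      have "(\<Prod>j=1..r. ?g j) = (\<Prod>j=1..r-1. ?g j)"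
      proof (rule prod.mono_neutral_right)
        show "\<forall>j\<in>{1..r} - {1..r-1}. ?g j = 1"
        proof
          fix j assume "j \<in> {1..r} - {1..r-1}"
          then have "j = r" by auto
          then show "?g j = 1" by simp
        qed
      qed auto
      then show ?thesis
        by (simp only: component_coeff_def B_def prod.distrib prod_dividef power_sum)
    qed
    have "T_op q b c p = (\<Sum>k\<in>(\<Pi>\<^sub>E j\<in>{1..r}. {0..n j}).
        smult (?coeff k) (cdqH_basis b c (\<Sum>j=1..r. k j)))"
      unfolding T_op_eq
      by (subst eq_sum_component_monoms[OF B(1) p]) (simp_all only: basis_change_sum basis_change_monom)
    then show ?thesis
      unfolding coeff by (simp add: poly_sum cdqH_basis_def poly_qbasis)
  qed
  ultimately show ?thesis
    unfolding Let_def p_def A_def by blast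
qed

end
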